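(* Let $\mathcal{P}=\{x\in\mathbb{R}^n: Ax=b,\ x(i)\ge0\ \forall i\in\mathcal{I}\}$ be a polytope with vertex set $\mathcal{V}$, normalized so that for every $v\in\mathcal{V}$ and $i\in\mathcal{I}$ either $v(i)=0$ or $v(i)\ge1$. Let $f:\mathbb{R}^n\to\mathbb{R}$ be convex, continuously differentiable and $\beta$-smooth, and suppose the quadratic growth condition with parameter $\alpha>0$ and the facial quadratic growth condition with parameter $\alpha_{\rm F}>0$ hold. Consider the Alternating Algorithm (described in the context) with fixed parameters $K_0\ge1$, $q>1$ and an arbitrary initialization point $x_1\in\mathcal{P}$. 1. Suppose $r^*<+\infty$. For any $\epsilon\in\left(0,\frac{\alpha r^{*2}}{2}\right)$, the Alternating Algorithm finds a point $x_\epsilon\in\mathcal{P}$ such that $f(x_\epsilon)-f^*\le\epsilon$ using at most $$O_{K_0,q}\left(\frac{\beta D^2}{\alpha r^{*2}}+|\mathcal{I}|+\max\left\{1,\frac{\beta D^2(d^*+1)}{\alpha_{\rm F}}\right\}\log_+\frac{\alpha r^{*2}}{2\epsilon}\right)$$ calls to the first-order oracle of $f$ and the face-constrained linear optimization oracle of $\mathcal{P}$. 2. Suppose $r^*=+\infty$. For any $\epsilon\in(0,\beta D^2)$, the Alternating Algorithm finds a point $x_\epsilon\in\mathcal{P}$ such that $f(x_\epsilon)-f^*\le\epsilon$ using at most $$O_{K_0,q}\left(|\mathcal{I}|+\max\left\{1,\frac{\beta D^2(d^*+1)}{\alpha_{\rm F}}\right\}\log_+\frac{\beta D^2}{\epsilon}\right)$$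 calls to the first-order oracle of $f$ and the face-constrained linear optimization oracle of $\mathcal{P}$.
   Context: Problem: minimize $f$ over the (nonempty, bounded) polytope $\mathcal{P}\subset\mathbb{R}^n$, $\mathcal{I}\subseteq[n]$. $\|\cdot\|$ is the Euclidean norm, $D$ the Euclidean diameter of $\mathcal{P}$, $\mathcal{X}^*$ the set of minimizers of $f$ over $\mathcal{P}$, $f^*$ the minimal value, $\mathrm{dist}(x,S)=\min_{y\in S}\|x-y\|$. $\beta$-smooth: $\nabla f$ is $\beta$-Lipschitz on $\mathbb{R}^n$. $\mathcal{F}^*$ is the minimal face of $\mathcal{P}$ containing $\mathcal{X}^*$, $d^*=\dim(\mathcal{F}^* )$. For $x\in\mathcal{P}$, $\mathcal{F}(x)=\{y\in\mathcal{P}: y(i)=0\text{ for all }i\in\mathcal{I}\text{ with }x(i)=0\}$. Quadratic growth: $\mathrm{dist}(x,\mathcal{X}^* )^2\le\frac{2}{\alpha}(f(x)-f^* )$ for all $x\in\mathcal{P}$. Facial quadratic growth: for every face $\mathcal{F}$ of $\mathcal{P}$ with $\mathcal{F}\cap\mathcal{X}^*\ne\emptyset$ and every $x\in\mathcal{F}$, $\mathrm{dist}(x,\mathcal{X}^*\cap\mathcal{F})^2\le\frac{2}{\alpha_{\rm F}}(f(x)-f^* )$. Critical distance $r^*$: for $J\subseteq\mathcal{I}$ let $x_J$ be the restriction of $x$ to coordinates in $J$ and $\mathcal{F}_J=\{x\in\mathcal{P}: x(i)=0\ \forall i\in J\}$. Let $\mathcal{J}_{\rm bad}=\{J\subseteq\mathcal{I}:\mathcal{F}_J\ne\emptyset,\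 \mathcal{F}_J\cap\mathcal{X}^*=\emptyset\}$. Then $r^*=+\infty$ if $\mathcal{J}_{\rm bad}=\emptyset$, and otherwise $r^*=\min_{J\in\mathcal{J}_{\rm bad}}\min_{x^*\in\mathcal{X}^*}\|(x^* )_J\|$. Oracles: the first-order oracle returns $f(x)$, $\nabla f(x)$ at a query point; the face-constrained linear optimization oracle, given $c\in\mathbb{R}^n$ and $J\subseteq\mathcal{I}$, returns an element of $\arg\min_{v\in\mathcal{V}\cap\mathcal{F}_J}\langle v,c\rangle$. Exact line-searches are not counted as oracle calls. Ties are broken arbitrarily. Algorithm CG($T$, $x_1$): for $t=1,\dots,T$: $v_{t,+}\in\arg\min_{v\in\mathcal{V}}\langle v,\nabla f(x_t)\rangle$; $\eta_t\in\arg\min_{\eta\in[0,1]}f(x_t+\eta(v_{t,+}-x_t))$; $x_{t+1}=x_t+\eta_t(v_{t,+}-x_t)$. Output $x_{T+1}$. Algorithm FM (Face-Monotone Away-step Decomposition-Invariant CG)($T$, $x_1$): for $t=1,\dots,T$: - $v_{t,+}\in\arg\min_{v\in\mathcal{V}\cap\mathcal{F}(x_t)}\langle v,\nabla f(x_t)\rangle$; if $\langle x_t-v_{t,+},\nabla f(x_t)\rangle=0$, return $x_t$; - $v_{t,-}\in\arg\max_{v\in\mathcal{V}\cap\mathcal{F}(x_t)}\langle v,\nabla f(x_t)\rangle$; - if $\langle x_t-v_{t,+},\nabla f(x_t)\rangle>\langle v_{t,-}-x_t,\nabla f(x_t)\rangle$: $\eta_t\in\arg\min_{\eta\in[0,1]}f(x_t+\eta(v_{t,+}-x_t))$,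 $x_{t+1}=x_t+\eta_t(v_{t,+}-x_t)$; - otherwise: $\gamma_t=\max\{\gamma: x_t(i)+\gamma(x_t(i)-v_{t,-}(i))\ge0\ \forall i\in\mathcal{I}\}$, $\eta_t\in\arg\min_{\eta\in[0,\gamma_t]}f(x_t+\eta(x_t-v_{t,-}))$, $x_{t+1}=x_t+\eta_t(x_t-v_{t,-})$. Output $x_{T+1}$ if not returned earlier. Alternating Algorithm: input $x_1\in\mathcal{P}$, $K_0\ge1$, $q>1$. For $t=1,2,\dots$: $K_t=\lceil K_0q^{t-1}\rceil$; $y_{t+1}$ = output of CG($K_t$, $x_t$); $x_{t+1}$ = output of FM($K_t$, $y_{t+1}$). "Finds a point" means that such a point is among the points produced by the algorithm within the stated number of oracle calls. Notation: $\log_+(u)=\max\{0,\log u\}$. $O_{K_0,q}(\cdot)$ means that the hidden constants may depend on $K_0$ and $q$ but not on $\epsilon,\alpha,\alpha_{\rm F},\beta,D,r^*,d^*$, $|\mathcal{I}|$ (nor on the minimal positive vertex slack, normalized to $1$). *)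

theory Defs
  imports "HOL-Analysis.Analysis"
begin

text \<open>
  The hidden constant of the complexity bound must not depend on the dimension \<open>n\<close>, so \<open>n\<close> is
  quantified inside the statement and \<open>real ^ 'n\<close> cannot be used. All the spaces \<open>\<real>\<^sup>n\<close> are realised
  as the subspaces \<^emph>\<open>sequences supported in \<open>{..<n}\<close>\<close> of the inner product space of finitely supported
  real sequences. Coordinates are numbered from \<open>0\<close>.
\<close>

typedef fseq = "{x :: nat \<Rightarrow> real. finite {i. x i \<noteq> 0}}"
  morphisms coord Abs_fseq
  by (rule exI[of _ "\<lambda>_. 0"]) simp

lemma finite_supp [simp]: "finite {i. coord x i \<noteq> 0}"
  using coord[of x] by simp

lemma fseq_eq_iff: "x = y \<longleftrightarrow> (\<forall>i. coord x i = coord y i)"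
  by (metis coord_inject ext)

lemma finite_supp2: "h 0 0 = 0 \<Longrightarrow> finite {i. h (coord x i) (coord y i) \<noteq> (0::real)}"
  by (rule finite_subset[of _ "{i. coord x i \<noteq> 0} \<union> {i. coord y i \<noteq> 0}"]) auto

instantiation fseq :: real_inner
begin

definition "0 = Abs_fseq (\<lambda>_. 0)"
definition "x + y = Abs_fseq (\<lambda>i. coord x i + coord y i)"
definition "x - y = Abs_fseq (\<lambda>i. coord x i - coord y i)"
definition "- x = Abs_fseq (\<lambda>i. - coord x i)"
definition "c *\<^sub>R x = Abs_fseq (\<lambda>i. c * coord x i)"
definition inner_fseq :: "fseq \<Rightarrow> fseq \<Rightarrow> real" where
  "inner_fseq x y = (\<Sum>i | coord x i \<noteq> 0. coord x i * coord y i)"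
definition norm_fseq :: "fseq \<Rightarrow> real" where
  "norm_fseq x = sqrt (inner x x)"
definition dist_fseq :: "fseq \<Rightarrow> fseq \<Rightarrow> real" where
  "dist_fseq x y = norm (x - y)"
definition sgn_fseq :: "fseq \<Rightarrow> fseq" where
  "sgn_fseq x = inverse (norm x) *\<^sub>R x"
definition uniformity_fseq :: "(fseq \<times> fseq) filter" where
  "uniformity_fseq = (INF e\<in>{0<..}. principal {(x, y). dist x y < e})"
definition open_fseq :: "fseq set \<Rightarrow> bool" where
  "open_fseq U \<longleftrightarrow> (\<forall>x\<in>U. \<forall>\<^sub>F (x', y) in uniformity. x' = x \<longrightarrow> y \<in> U)"

lemma coord_0 [simp]: "coord 0 i = 0"
  by (simp add: zero_fseq_def Abs_fseq_inverse)

lemma coord_add [simp]: "coord (x + y) i = coord x i + coord y i"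
  by (simp add: plus_fseq_def Abs_fseq_inverse finite_supp2)

lemma coord_diff [simp]: "coord (x - y) i = coord x i - coord y i"
  by (simp add: minus_fseq_def Abs_fseq_inverse finite_supp2[where h = "\<lambda>a b. a - b", simplified])

lemma coord_minus [simp]: "coord (- x) i = - coord x i"
  by (simp add: uminus_fseq_def Abs_fseq_inverse)

lemma coord_scaleR [simp]: "coord (c *\<^sub>R x) i = c * coord x i"
  by (simp add: scaleR_fseq_def Abs_fseq_inverse)

lemma inner_fseq_superset:
  assumes "finite S" "{i. coord x i \<noteq> 0} \<subseteq> S"
  shows "inner x y = (\<Sum>i\<in>S. coord x i * coord y i)"
  unfolding inner_fseq_def using assms by (intro sum.mono_neutral_left) auto

instance
proof
  fix x y z :: fseq and a b r :: real and U :: "fseq set"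
  show "x + y + z = x + (y + z)" "x + y = y + x" "0 + x = x" "- x + x = 0" "x - y = x + - y"
    "a *\<^sub>R (x + y) = a *\<^sub>R x + a *\<^sub>R y" "(a + b) *\<^sub>R x = a *\<^sub>R x + b *\<^sub>R x"
    "a *\<^sub>R b *\<^sub>R x = (a * b) *\<^sub>R x" "1 *\<^sub>R x = x"
    by (simp_all add: fseq_eq_iff algebra_simps)
  show "sgn x = inverse (norm x) *\<^sub>R x" by (rule sgn_fseq_def)
  show "dist x y = norm (x - y)" by (rule dist_fseq_def)
  show "(uniformity :: (fseq \<times> fseq) filter) = (INF e\<in>{0<..}. principal {(x, y). dist x y < e})"
    by (rule uniformity_fseq_def)
  show "open U \<longleftrightarrow> (\<forall>x\<in>U. \<forall>\<^sub>F (x', y) in uniformity. x' = x \<longrightarrow> y \<in> U)"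
    by (rule open_fseq_def)
  show "norm x = sqrt (inner x x)" by (rule norm_fseq_def)
  let ?S = "{i. coord x i \<noteq> 0} \<union> {i. coord y i \<noteq> 0}"
  have S: "inner x w = (\<Sum>i\<in>?S. coord x i * coord w i)"
    "inner y w = (\<Sum>i\<in>?S. coord y i * coord w i)"
    "inner (x + y) w = (\<Sum>i\<in>?S. coord (x + y) i * coord w i)"
    "inner (r *\<^sub>R x) w = (\<Sum>i\<in>?S. coord (r *\<^sub>R x) i * coord w i)" for w
    by (rule inner_fseq_superset; auto)+
  show "inner x y = inner y x" by (simp add: S mult.commute)
  show "inner (x + y) z = inner x z + inner y z"
    by (simp add: S sum.distrib algebra_simps)
  show "inner (r *\<^sub>R x) y = r * inner x y"
    by (simp add: S sum_distrib_left algebra_simps)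
  show "0 \<le> inner x x" by (simp add: inner_fseq_def sum_nonneg)
  show "inner x x = 0 \<longleftrightarrow> x = 0"
    by (auto simp: inner_fseq_def sum_nonneg_eq_0_iff fseq_eq_iff)
qed

end

definition Rn :: "nat \<Rightarrow> fseq set" where
  "Rn n = {x. \<forall>i\<ge>n. coord x i = 0}"

lemma inner_Rn: "x \<in> Rn n \<Longrightarrow> x \<bullet> y = (\<Sum>i<n. coord x i * coord y i)"
  by (rule inner_fseq_superset) (auto simp: Rn_def not_le[symmetric])

lemma norm_Rn: "x \<in> Rn n \<Longrightarrow> norm x = L2_set (coord x) {..<n}"
  by (simp add: norm_eq_sqrt_inner inner_Rn L2_set_def power2_eq_square)

lemma coord_in_Rn_exists: "\<exists>x\<in>Rn n. \<forall>i<n. coord x i = a i"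
proof
  have fin: "finite {i. (if i < n then a i else 0) \<noteq> 0}"
    by (rule finite_subset[of _ "{..<n}"]) (auto split: if_splits)
  let ?x = "Abs_fseq (\<lambda>i. if i < n then a i else 0)"
  have "coord ?x = (\<lambda>i. if i < n then a i else 0)"
    using fin by (intro Abs_fseq_inverse) simp
  then show "?x \<in> Rn n" "\<forall>i<n. coord ?x i = a i"
    by (auto simp: Rn_def)
qed


section \<open>The polytope and the objective\<close>

text \<open>\<open>A\<close> is an \<open>m \<times> n\<close> matrix and \<open>b\<close> a vector with \<open>m\<close> entries; other entries are irrelevant.\<close>

definition polyhedron_of ::
    "nat \<Rightarrow> nat \<Rightarrow> (nat \<Rightarrow> nat \<Rightarrow> real) \<Rightarrow> (nat \<Rightarrow> real) \<Rightarrow> nat set \<Rightarrow> fseq set" where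
  "polyhedron_of n m A b I =
    {x \<in> Rn n. (\<forall>k<m. (\<Sum>j<n. A k j * coord x j) = b k) \<and> (\<forall>i\<in>I. coord x i \<ge> 0)}"

definition verts :: "fseq set \<Rightarrow> fseq set" where
  "verts P = {v. v extreme_point_of P}"

definition face_fix :: "fseq set \<Rightarrow> nat set \<Rightarrow> fseq set" where
  "face_fix P J = {x \<in> P. \<forall>i\<in>J. coord x i = 0}"

definition face_at :: "fseq set \<Rightarrow> nat set \<Rightarrow> fseq \<Rightarrow> fseq set" where
  "face_at P I x = {y \<in> P. \<forall>i\<in>I. coord x i = 0 \<longrightarrow> coord y i = 0}"

text \<open>The derivative is taken within \<open>\<real>\<^sup>n\<close>; requiring \<open>g x \<in> \<real>\<^sup>n\<close> makes \<open>g x\<close> unique.\<close>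

definition gradient_on :: "nat \<Rightarrow> (fseq \<Rightarrow> real) \<Rightarrow> (fseq \<Rightarrow> fseq) \<Rightarrow> bool" where
  "gradient_on n f g \<longleftrightarrow>
    (\<forall>x\<in>Rn n. g x \<in> Rn n \<and> (f has_derivative (\<lambda>h. g x \<bullet> h)) (at x within Rn n))"

definition minimizers :: "(fseq \<Rightarrow> real) \<Rightarrow> fseq set \<Rightarrow> fseq set" where
  "minimizers f P = {x. is_arg_min f (\<lambda>y. y \<in> P) x}"

definition min_value :: "(fseq \<Rightarrow> real) \<Rightarrow> fseq set \<Rightarrow> real" where
  "min_value f P = Inf (f ` P)"

definition quadratic_growth :: "(fseq \<Rightarrow> real) \<Rightarrow> fseq set \<Rightarrow> real \<Rightarrow> bool" where
  "quadratic_growth f P \<alpha> \<longleftrightarrow>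
    (\<forall>x\<in>P. (infdist x (minimizers f P))\<^sup>2 \<le> 2 / \<alpha> * (f x - min_value f P))"

definition facial_quadratic_growth :: "(fseq \<Rightarrow> real) \<Rightarrow> fseq set \<Rightarrow> real \<Rightarrow> bool" where
  "facial_quadratic_growth f P \<alpha>F \<longleftrightarrow>
    (\<forall>F. F face_of P \<and> F \<inter> minimizers f P \<noteq> {} \<longrightarrow>
      (\<forall>x\<in>F. (infdist x (minimizers f P \<inter> F))\<^sup>2 \<le> 2 / \<alpha>F * (f x - min_value f P)))"

definition optimal_face :: "(fseq \<Rightarrow> real) \<Rightarrow> fseq set \<Rightarrow> fseq set" where
  "optimal_face f P = \<Inter> {F. F face_of P \<and> minimizers f P \<subseteq> F}"

text \<open>Dimension of the affine hull, as the dimension of its direction space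
  (the library's \<open>aff_dim\<close> exists only for \<open>euclidean_space\<close>).\<close>

definition affine_dim :: "fseq set \<Rightarrow> nat" where
  "affine_dim S = dim {x - y | x y. x \<in> S \<and> y \<in> S}"

definition bad_sets :: "(fseq \<Rightarrow> real) \<Rightarrow> fseq set \<Rightarrow> nat set \<Rightarrow> nat set set" where
  "bad_sets f P I =
    {J. J \<subseteq> I \<and> face_fix P J \<noteq> {} \<and> face_fix P J \<inter> minimizers f P = {}}"

text \<open>An infimum over the empty set is \<open>\<infinity>\<close> in \<open>ereal\<close>, which is the convention for \<open>r\<^sup>*\<close> when there
  is no bad set. Otherwise the infima are minima, since \<open>I\<close> is finite and the set of minimizers
  compact.\<close>

definition critical_distance :: "(fseq \<Rightarrow> real) \<Rightarrow> fseq set \<Rightarrow> nat set \<Rightarrow> ereal" where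
  "critical_distance f P I =
    (INF J\<in>bad_sets f P I. INF x\<in>minimizers f P. ereal (L2_set (coord x) J))"

definition log_plus :: "real \<Rightarrow> real" where
  "log_plus u = max 0 (ln u)"


section \<open>The algorithms\<close>

text \<open>All choices (oracle answers and line searches) are nondeterministic: a step is a relation
  between the current and the next iterate.\<close>

definition exact_line_search :: "(fseq \<Rightarrow> real) \<Rightarrow> fseq \<Rightarrow> fseq \<Rightarrow> real \<Rightarrow> real \<Rightarrow> bool" where
  "exact_line_search f x d \<gamma> \<eta> \<longleftrightarrow> is_arg_min (\<lambda>s. f (x + s *\<^sub>R d)) (\<lambda>s. s \<in> {0..\<gamma>}) \<eta>"

definition cg_step :: "(fseq \<Rightarrow> real) \<Rightarrow> (fseq \<Rightarrow> fseq) \<Rightarrow> fseq set \<Rightarrow> fseq \<Rightarrow> fseq \<Rightarrow> bool" where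
  "cg_step f g P x x' \<longleftrightarrow>
    (\<exists>v \<eta>. is_arg_min (\<lambda>v. v \<bullet> g x) (\<lambda>v. v \<in> verts P) v \<and>
      exact_line_search f x (v - x) 1 \<eta> \<and> x' = x + \<eta> *\<^sub>R (v - x))"

definition toward_vertex :: "(fseq \<Rightarrow> fseq) \<Rightarrow> fseq set \<Rightarrow> nat set \<Rightarrow> fseq \<Rightarrow> fseq \<Rightarrow> bool" where
  "toward_vertex g P I x v \<longleftrightarrow>
    is_arg_min (\<lambda>v. v \<bullet> g x) (\<lambda>v. v \<in> verts P \<inter> face_at P I x) v"

definition away_vertex :: "(fseq \<Rightarrow> fseq) \<Rightarrow> fseq set \<Rightarrow> nat set \<Rightarrow> fseq \<Rightarrow> fseq \<Rightarrow> bool" where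
  "away_vertex g P I x v \<longleftrightarrow>
    is_arg_max (\<lambda>v. v \<bullet> g x) (\<lambda>v. v \<in> verts P \<inter> face_at P I x) v"

definition max_away_step :: "nat set \<Rightarrow> fseq \<Rightarrow> fseq \<Rightarrow> real \<Rightarrow> bool" where
  "max_away_step I x v \<gamma> \<longleftrightarrow>
    is_arg_max (\<lambda>s. s) (\<lambda>s. \<forall>i\<in>I. coord x i + s * (coord x i - coord v i) \<ge> 0) \<gamma>"

definition fm_stop :: "(fseq \<Rightarrow> fseq) \<Rightarrow> fseq set \<Rightarrow> nat set \<Rightarrow> fseq \<Rightarrow> bool" where
  "fm_stop g P I x \<longleftrightarrow> (\<exists>v. toward_vertex g P I x v \<and> (x - v) \<bullet> g x = 0)"

definition fm_step ::
    "(fseq \<Rightarrow> real) \<Rightarrow> (fseq \<Rightarrow> fseq) \<Rightarrow> fseq set \<Rightarrow> nat set \<Rightarrow> fseq \<Rightarrow> fseq \<Rightarrow> bool" where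
  "fm_step f g P I x x' \<longleftrightarrow>
    (\<exists>v w. toward_vertex g P I x v \<and> (x - v) \<bullet> g x \<noteq> 0 \<and> away_vertex g P I x w \<and>
      (if (x - v) \<bullet> g x > (w - x) \<bullet> g x
       then \<exists>\<eta>. exact_line_search f x (v - x) 1 \<eta> \<and> x' = x + \<eta> *\<^sub>R (v - x)
       else \<exists>\<gamma> \<eta>. max_away_step I x w \<gamma> \<and> exact_line_search f x (x - w) \<gamma> \<eta> \<and>
              x' = x + \<eta> *\<^sub>R (x - w)))"

text \<open>A trace is the list of all iterates of one run, starting with its input and ending with its
  output. A trace of FM with fewer than \<open>K\<close> steps ends with an early return.\<close>

definition cg_trace ::
    "(fseq \<Rightarrow> real) \<Rightarrow> (fseq \<Rightarrow> fseq) \<Rightarrow> fseq set \<Rightarrow> nat \<Rightarrow> fseq list \<Rightarrow> bool" where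
  "cg_trace f g P K xs \<longleftrightarrow>
    length xs = Suc K \<and> (\<forall>j<K. cg_step f g P (xs ! j) (xs ! Suc j))"

definition fm_trace ::
    "(fseq \<Rightarrow> real) \<Rightarrow> (fseq \<Rightarrow> fseq) \<Rightarrow> fseq set \<Rightarrow> nat set \<Rightarrow> nat \<Rightarrow> fseq list \<Rightarrow> bool" where
  "fm_trace f g P I K xs \<longleftrightarrow>
    xs \<noteq> [] \<and> length xs \<le> Suc K \<and>
    (\<forall>j. Suc j < length xs \<longrightarrow> fm_step f g P I (xs ! j) (xs ! Suc j)) \<and>
    (length xs < Suc K \<longrightarrow> fm_stop g P I (last xs))"

text \<open>Phases are numbered from \<open>0\<close>, whence the exponent \<open>t\<close> in place of \<open>t - 1\<close>.\<close>

definition phase_length :: "real \<Rightarrow> real \<Rightarrow> nat \<Rightarrow> nat" where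
  "phase_length K0 q t = nat \<lceil>K0 * q ^ t\<rceil>"

text \<open>In phase \<open>t\<close>, \<open>cs t\<close> is the trace of CG and \<open>fs t\<close> the trace of FM.\<close>

definition alternating_run ::
    "(fseq \<Rightarrow> real) \<Rightarrow> (fseq \<Rightarrow> fseq) \<Rightarrow> fseq set \<Rightarrow> nat set \<Rightarrow> real \<Rightarrow> real \<Rightarrow> fseq \<Rightarrow>
      (nat \<Rightarrow> fseq list) \<Rightarrow> (nat \<Rightarrow> fseq list) \<Rightarrow> bool" where
  "alternating_run f g P I K0 q x1 cs fs \<longleftrightarrow>
    hd (cs 0) = x1 \<and>
    (\<forall>t. cg_trace f g P (phase_length K0 q t) (cs t) \<and>
         fm_trace f g P I (phase_length K0 q t) (fs t) \<and>
         hd (fs t) = last (cs t) \<and> hd (cs (Suc t)) = last (fs t))"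

text \<open>Oracle calls (first-order plus linear optimization): two per iteration of CG, three per
  complete iteration of FM, and two for the iteration in which FM returns early.\<close>

definition cg_calls :: "fseq list \<Rightarrow> nat" where
  "cg_calls xs = 2 * (length xs - 1)"

definition fm_calls :: "nat \<Rightarrow> fseq list \<Rightarrow> nat" where
  "fm_calls K xs = 3 * (length xs - 1) + (if length xs < Suc K then 2 else 0)"

definition calls_before ::
    "real \<Rightarrow> real \<Rightarrow> (nat \<Rightarrow> fseq list) \<Rightarrow> (nat \<Rightarrow> fseq list) \<Rightarrow> nat \<Rightarrow> nat" where
  "calls_before K0 q cs fs t = (\<Sum>s<t. cg_calls (cs s) + fm_calls (phase_length K0 q s) (fs s))"

text \<open>\<open>x\<close> is one of the iterates of the run, and exactly \<open>N\<close> oracle calls precede its production.\<close>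

definition produced_after ::
    "real \<Rightarrow> real \<Rightarrow> (nat \<Rightarrow> fseq list) \<Rightarrow> (nat \<Rightarrow> fseq list) \<Rightarrow> fseq \<Rightarrow> nat \<Rightarrow> bool" where
  "produced_after K0 q cs fs x N \<longleftrightarrow>
    (\<exists>t j. j < length (cs t) \<and> x = cs t ! j \<and> N = calls_before K0 q cs fs t + 2 * j) \<or>
    (\<exists>t j. j < length (fs t) \<and> x = fs t ! j \<and>
       N = calls_before K0 q cs fs t + cg_calls (cs t) + 3 * j)"

definition finds_within ::
    "(fseq \<Rightarrow> real) \<Rightarrow> fseq set \<Rightarrow> real \<Rightarrow> real \<Rightarrow> (nat \<Rightarrow> fseq list) \<Rightarrow> (nat \<Rightarrow> fseq list) \<Rightarrow>
      real \<Rightarrow> real \<Rightarrow> bool" where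
  "finds_within f P K0 q cs fs \<epsilon> B \<longleftrightarrow>
    (\<exists>x N. produced_after K0 q cs fs x N \<and> x \<in> P \<and> f x - min_value f P \<le> \<epsilon> \<and> real N \<le> B)"

end

theory Submission
  imports Defs
begin

text \<open>
  Conditional gradient steps drive the gap down like \<open>2 \<beta> D\<^sup>2 / (t + 1)\<close> after \<open>t\<close> steps. Once it is below a threshold
  \<open>H\<close> (\<open>\<alpha> r\<^sup>*\<^sup>2 / 2\<close>, or \<open>\<beta> D\<^sup>2\<close> if \<open>r\<^sup>* = \<infinity>\<close>), the face of every later iterate contains a minimizer \<open>y\<close>.
  Write \<open>y\<close> as a convex combination of \<open>k \<le> d\<^sup>* + 1\<close> vertices. The current point \<open>x\<close> is obtained from \<open>y\<close>
  by moving a mass of at most \<open>\<surd>k \<parallel>x - y\<parallel>\<close> away from these vertices, so the width of the face in gradient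
  direction is at least the gap divided by this mass, and facial quadratic growth turns this into
  linear convergence of the face-monotone steps, except for at most \<open>|I|\<close> steps that hit a new facet.
  Thus one sufficiently long phase suffices, and as the phase lengths grow geometrically, all the
  phases up to the first sufficiently long one cost only a constant factor more.
\<close>

section \<open>Finitely supported sequences and polyhedra\<close>

text \<open>A face-monotone step uses only vertices of the face of the current point, so it could be
  trapped on a face without minimizers. The threshold \<open>H\<close> excludes this: on such a face
  the coordinates that vanish form a bad set, all minimizers are at distance at least
  \<open>r*\<close>, and quadratic growth makes the gap at least \<alpha> \<open>r*\<close>^2 / 2. A
  later CG phase may leave every face reached so far, so zero coordinates gained in one phase are
  worth nothing in the next. Hence no potential is carried across phases: one phase does all the
  work from an arbitrary start, and it is long enough once its length reaches 2 \<beta> D^2 / H +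
  |I| + 16 \<kappa> ln (H / \<epsilon>). Two degenerate cases are treated apart: without sign
  constraints a bounded \<open>P\<close> is a single point, and for \<beta> D^2 = 0 the output of
  the CG part is already optimal.\<close>

lemma zero_in_Rn [simp]: "0 \<in> Rn n"
  by (simp add: Rn_def)

lemma Rn_add [simp]: "x \<in> Rn n \<Longrightarrow> y \<in> Rn n \<Longrightarrow> x + y \<in> Rn n"
  by (simp add: Rn_def)

lemma Rn_diff [simp]: "x \<in> Rn n \<Longrightarrow> y \<in> Rn n \<Longrightarrow> x - y \<in> Rn n"
  by (simp add: Rn_def)

lemma Rn_scaleR [simp]: "x \<in> Rn n \<Longrightarrow> c *\<^sub>R x \<in> Rn n"
  by (simp add: Rn_def)

lemma coord_sum [simp]: "coord (sum h S) i = (\<Sum>v\<in>S. coord (h v) i)"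
  by (induction S rule: infinite_finite_induct) auto

lemma subspace_Rn: "subspace (Rn n)"
  by (simp add: subspace_def)

text \<open>Exchange argument: the unit vectors \<open>e\<close> span \<open>Rn n\<close>, so every
  independent subset of \<open>V\<close> is finite, and then no independent subset is larger than a
  basis of \<open>V\<close>. This turns affine independence of vertices into a bound by the
  dimension of a face.\<close>

lemma independent_card_le_dim_Rn:
  assumes B: "independent B" "B \<subseteq> V" and V: "V \<subseteq> Rn n"
  shows "finite B" "card B \<le> dim V"
proof -
  obtain e where e: "\<And>i. e i \<in> Rn n" "\<And>i j. j < n \<Longrightarrow> coord (e i) j = (if j = i then 1 else (0::real))"
  proof -
    have "\<forall>i. \<exists>x\<in>Rn n. \<forall>j<n. coord x j = (if j = i then 1 else (0::real))"
      by (intro allI coord_in_Rn_exists)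
    then have "\<exists>e. \<forall>i. e i \<in> Rn n \<and> (\<forall>j<n. coord (e i) j = (if j = i then 1 else (0::real)))"
      unfolding Bex_def by (rule choice)
    then show ?thesis using that by auto
  qed
  have "Rn n \<subseteq> span (e ` {..<n})"
  proof
    fix x assume x: "x \<in> Rn n"
    have "x = (\<Sum>i<n. coord x i *\<^sub>R e i)"
      unfolding fseq_eq_iff
    proof
      fix j
      show "coord x j = coord (\<Sum>i<n. coord x i *\<^sub>R e i) j"
      proof (cases "j < n")
        case True
        then have "(\<Sum>i<n. coord x i * coord (e i) j) = (\<Sum>i<n. if i = j then coord x i else 0)"
          using e(2) by (intro sum.cong) auto
        then show ?thesis using True by simp
      next
        case False
        then show ?thesis using e(1) x by (simp add: Rn_def)
      qed
    qed
    also have "\<dots> \<in> span (e ` {..<n})"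
      by (intro span_sum span_scale span_base) auto
    finally show "x \<in> span (e ` {..<n})" .
  qed
  with V have VR: "V \<subseteq> span (e ` {..<n})" by auto
  have fin: "finite B'" if "independent B'" "B' \<subseteq> V" for B'
    using independent_span_bound[of "e ` {..<n}" B'] that VR by auto
  show "finite B" using fin B by auto
  obtain B' where B': "B' \<subseteq> V" "independent B'" "V \<subseteq> span B'" "card B' = dim V"
    using basis_exists by metis
  have "card B \<le> card B'"
    using independent_span_bound[of B' B] fin[OF B'(2,1)] B B' by auto
  with B' show "card B \<le> dim V" by simp
qed

text \<open>Splitting off one vertex \<open>v\<close>, the combination lies strictly between
  \<open>v\<close> and the normalized rest \<open>y\<close>, so the defining property of a face
  applies, unless \<open>y = v\<close>, when the combination is \<open>v\<close> itself.\<close>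

lemma convex_combination_in_face:
  assumes F: "F face_of P" and P: "convex P" and S: "finite S" "S \<subseteq> P"
    and l: "\<And>v. v \<in> S \<Longrightarrow> 0 < l v" "sum l S = (1::real)"
    and x: "(\<Sum>v\<in>S. l v *\<^sub>R v) \<in> F"
  shows "S \<subseteq> F"
proof
  fix v assume v: "v \<in> S"
  let ?x = "\<Sum>v\<in>S. l v *\<^sub>R v"
  show "v \<in> F"
  proof (cases "S = {v}")
    case True
    then show ?thesis using x l by auto
  next
    case False
    then have ne: "S - {v} \<noteq> {}" using v by auto
    have pos: "0 < sum l (S - {v})" using ne S l by (intro sum_pos) auto
    have 1: "sum l (S - {v}) = 1 - l v"
      using l S v by (simp add: sum_diff1)
    define y where "y = (\<Sum>u\<in>S - {v}. (l u / (1 - l v)) *\<^sub>R u)"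
    have "y \<in> P" unfolding y_def
      using S l pos 1 P
      by (intro convex_sum) (auto simp: sum_divide_distrib[symmetric] less_imp_le)
    have "(1 - l v) *\<^sub>R y = (\<Sum>u\<in>S - {v}. l u *\<^sub>R u)"
      using pos 1 by (simp add: y_def scaleR_sum_right)
    then have xy: "?x = (1 - l v) *\<^sub>R y + l v *\<^sub>R v"
      using S v by (simp add: sum.remove add.commute)
    show ?thesis
    proof (cases "y = v")
      case True
      then show ?thesis using xy x by (simp add: algebra_simps)
    next
      case False
      then have "?x \<in> open_segment y v"
        unfolding in_segment using xy pos 1 l(1)[OF v] by auto
      then show ?thesis using F x \<open>y \<in> P\<close> S v unfolding face_of_def by blast
    qed
  qed
qed

text \<open>The points of \<open>S\<close> are served one after another, each with the largest
  weight up to \<open>l v\<close> that keeps the partial sum below \<open>x\<close> on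
  \<open>I\<close>. A point that gets less than \<open>l v\<close> is blocked by a tight coordinate,
  and by nonnegativity a tight coordinate stays tight when further points are served.\<close>

lemma greedy_weights:
  assumes "finite S" "finite I"
    and "\<And>v i. v \<in> S \<Longrightarrow> i \<in> I \<Longrightarrow> 0 \<le> coord v i"
    and "\<And>v. v \<in> S \<Longrightarrow> 0 \<le> l v"
    and "\<And>i. i \<in> I \<Longrightarrow> 0 \<le> coord x i"
  shows "\<exists>\<mu>. (\<forall>v\<in>S. 0 \<le> \<mu> v \<and> \<mu> v \<le> l v) \<and>
    (\<forall>i\<in>I. (\<Sum>v\<in>S. \<mu> v * coord v i) \<le> coord x i) \<and>
    (\<forall>v\<in>S. \<mu> v < l v \<longrightarrow> (\<exists>i\<in>I. 0 < coord v i \<and> (\<Sum>v\<in>S. \<mu> v * coord v i) = coord x i))"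
  using assms(1,3,4)
proof (induction S)
  case empty
  then show ?case using assms by auto
next
  case (insert v S)
  have "\<exists>\<mu>. (\<forall>v\<in>S. 0 \<le> \<mu> v \<and> \<mu> v \<le> l v) \<and>
      (\<forall>i\<in>I. (\<Sum>v\<in>S. \<mu> v * coord v i) \<le> coord x i) \<and>
      (\<forall>v\<in>S. \<mu> v < l v \<longrightarrow> (\<exists>i\<in>I. 0 < coord v i \<and> (\<Sum>v\<in>S. \<mu> v * coord v i) = coord x i))"
    by (rule insert.IH) (simp_all add: insert.prems)
  then obtain \<mu> where \<mu>: "\<And>v. v \<in> S \<Longrightarrow> 0 \<le> \<mu> v \<and> \<mu> v \<le> l v"
      "\<And>i. i \<in> I \<Longrightarrow> (\<Sum>v\<in>S. \<mu> v * coord v i) \<le> coord x i"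
      "\<And>v. v \<in> S \<Longrightarrow> \<mu> v < l v \<Longrightarrow> \<exists>i\<in>I. 0 < coord v i \<and> (\<Sum>v\<in>S. \<mu> v * coord v i) = coord x i"
    by blast
  define r where "r i = coord x i - (\<Sum>v\<in>S. \<mu> v * coord v i)" for i
  define Q where "Q = insert (l v) ((\<lambda>i. r i / coord v i) ` {i \<in> I. 0 < coord v i})"
  define t where "t = Min Q"
  define \<mu>' where "\<mu>' = \<mu>(v := t)"
  have Q: "finite Q" "Q \<noteq> {}" using assms by (auto simp: Q_def)
  have r: "0 \<le> r i" if "i \<in> I" for i using \<mu>(2)[OF that] by (simp add: r_def)
  have t_nn: "0 \<le> t" unfolding t_def
    using Q r insert.prems by (subst Min_ge_iff) (auto simp: Q_def)
  have t_le: "t \<le> l v" unfolding t_def using Q by (intro Min_le) (auto simp: Q_def)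
  have t_r: "t * coord v i \<le> r i" if "i \<in> I" for i
  proof (cases "0 < coord v i")
    case True
    then have "t \<le> r i / coord v i" unfolding t_def using Q that by (intro Min_le) (auto simp: Q_def)
    then show ?thesis using True by (simp add: field_simps)
  next
    case False
    then have "coord v i = 0" using insert.prems(1)[of v i] that by auto
    then show ?thesis using r that by auto
  qed
  have sum': "(\<Sum>u\<in>insert v S. \<mu>' u * coord u i) = t * coord v i + (coord x i - r i)" for i
  proof -
    have "(\<Sum>u\<in>S. \<mu>' u * coord u i) = (\<Sum>u\<in>S. \<mu> u * coord u i)"
      using insert.hyps by (intro sum.cong) (auto simp: \<mu>'_def)
    then show ?thesis using insert.hyps by (simp add: r_def \<mu>'_def)
  qed
  have tight: "\<exists>i\<in>I. 0 < coord u i \<and> (\<Sum>w\<in>insert v S. \<mu>' w * coord w i) = coord x i"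
    if u: "u \<in> insert v S" "\<mu>' u < l u" for u
  proof (cases "u = v")
    case True
    then have "t \<noteq> l v" using u by (auto simp: \<mu>'_def)
    moreover have "t \<in> Q" unfolding t_def using Q by (intro Min_in)
    ultimately obtain i where "i \<in> I" "0 < coord v i" "t = r i / coord v i"
      by (auto simp: Q_def)
    then show ?thesis using True by (intro bexI[of _ i]) (auto simp: sum')
  next
    case False
    then obtain i where i: "i \<in> I" "0 < coord u i" "r i = 0"
      using u \<mu>(3)[of u] by (auto simp: r_def \<mu>'_def)
    have "0 \<le> t * coord v i" using t_nn insert.prems(1)[of v i] i by simp
    then have "t * coord v i = 0" using t_r[OF i(1)] i by linarith
    then show ?thesis using i by (intro bexI[of _ i]) (auto simp: sum')
  qed
  show ?case
  proof (intro exI[of _ \<mu>'] conjI ballI impI)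
    fix i assume "i \<in> I"
    then show "(\<Sum>u\<in>insert v S. \<mu>' u * coord u i) \<le> coord x i" using t_r[of i] by (simp add: sum')
  next
    fix u assume "u \<in> insert v S" "\<mu>' u < l u"
    then show "\<exists>i\<in>I. 0 < coord u i \<and> (\<Sum>u\<in>insert v S. \<mu>' u * coord u i) = coord x i"
      by (rule tight)
  qed (use \<mu>(1) t_nn t_le in \<open>auto simp: \<mu>'_def\<close>)
qed

section \<open>Faces, vertices and compactness of a bounded polyhedron\<close>

locale bounded_polyhedron =
  fixes n m :: nat and A :: "nat \<Rightarrow> nat \<Rightarrow> real" and b :: "nat \<Rightarrow> real" and I :: "nat set"
    and P :: "fseq set"
  assumes I_sub: "I \<subseteq> {..<n}" and P_eq: "P = polyhedron_of n m A b I"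
    and bounded_P: "bounded P"
begin

definition null_direction :: "fseq \<Rightarrow> bool" where
  "null_direction d \<longleftrightarrow> d \<in> Rn n \<and> (\<forall>k<m. (\<Sum>j<n. A k j * coord d j) = 0)"

abbreviation zeros :: "fseq \<Rightarrow> nat set" where
  "zeros x \<equiv> {i \<in> I. coord x i = 0}"

lemma finite_I [simp]: "finite I"
  using I_sub finite_subset by blast

lemma P_sub_Rn: "x \<in> P \<Longrightarrow> x \<in> Rn n"
  by (simp add: P_eq polyhedron_of_def)

lemma P_nonneg: "x \<in> P \<Longrightarrow> i \<in> I \<Longrightarrow> 0 \<le> coord x i"
  by (simp add: P_eq polyhedron_of_def)

lemma convex_P: "convex P"
  by (auto simp: convex_def P_eq polyhedron_of_def distrib_left mult.left_commute sum.distrib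
      sum_distrib_left[symmetric] distrib_right[symmetric])

lemma null_direction_diff: "x \<in> P \<Longrightarrow> y \<in> P \<Longrightarrow> null_direction (x - y)"
  by (auto simp: null_direction_def P_eq polyhedron_of_def right_diff_distrib sum_subtractf)

lemma null_direction_scaleR: "null_direction d \<Longrightarrow> null_direction (c *\<^sub>R d)"
  by (auto simp: null_direction_def mult.left_commute sum_distrib_left[symmetric])

lemma move_in_P:
  assumes "x \<in> P" "null_direction d" "\<And>i. i \<in> I \<Longrightarrow> 0 \<le> coord x i + coord d i"
  shows "x + d \<in> P"
  using assms by (auto simp: null_direction_def P_eq polyhedron_of_def distrib_left sum.distrib)

text \<open>Otherwise the whole ray from \<open>x\<close> in direction \<open>d\<close> would lie in
  \<open>P\<close>, against boundedness.\<close>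

lemma null_direction_neg_coord:
  assumes "x \<in> P" "null_direction d" "d \<noteq> 0"
  obtains i where "i \<in> I" "coord d i < 0"
proof (rule ccontr)
  assume "\<not> thesis"
  with that have nn: "\<And>i. i \<in> I \<Longrightarrow> 0 \<le> coord d i" by (metis not_less)
  obtain B where B: "\<And>y. y \<in> P \<Longrightarrow> norm y \<le> B" using bounded_P by (auto simp: bounded_iff)
  \<comment> \<open>Chosen such that \<open>s *\<^sub>R d\<close> has norm
    \<open>B + norm x + 1\<close>, which carries the point out of the ball of radius
    \<open>B\<close>.\<close>
  define s where "s = (B + norm x + 1) / norm d"
  have "0 \<le> B" using B[OF assms(1)] norm_ge_zero order_trans by blast
  then have s: "0 \<le> s" by (simp add: s_def)
  have "x + s *\<^sub>R d \<in> P"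
    using assms nn s P_nonneg[OF assms(1)] by (intro move_in_P null_direction_scaleR) auto
  then have "norm (x + s *\<^sub>R d) \<le> B" by (rule B)
  moreover have "norm (s *\<^sub>R d) = B + norm x + 1" using assms \<open>0 \<le> B\<close> by (simp add: s_def)
  moreover have "norm (s *\<^sub>R d) \<le> norm (x + s *\<^sub>R d) + norm x"
    by (metis add_diff_cancel_left' norm_triangle_ineq4)
  ultimately show False by linarith
qed

text \<open>The ratio test of the simplex method. The step is positive because \<open>d\<close>
  vanishes wherever \<open>x\<close> does, and it is finite because some coordinate of
  \<open>d\<close> is negative.\<close>

lemma move_to_boundary:
  assumes x: "x \<in> P" and d: "null_direction d" "d \<noteq> 0" "\<And>i. i \<in> I \<Longrightarrow> coord x i = 0 \<Longrightarrow> coord d i = 0"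
  obtains s i where "0 < s" "x + s *\<^sub>R d \<in> P" "i \<in> I" "coord x i \<noteq> 0" "coord (x + s *\<^sub>R d) i = 0"
proof -
  define N where "N = {i \<in> I. coord d i < 0}"
  have N: "finite N" "N \<noteq> {}"
    using null_direction_neg_coord[OF x d(1,2)] by (auto simp: N_def)
  define Q where "Q = (\<lambda>i. coord x i / - coord d i) ` N"
  define s where "s = Min Q"
  have "s \<in> Q" unfolding s_def Q_def using N by (intro Min_in) auto
  then obtain i where i: "i \<in> N" "s = coord x i / - coord d i" by (auto simp: Q_def)
  have xi: "coord x i \<noteq> 0" "0 < coord x i" using i d(3)[of i] P_nonneg[OF x, of i] by (force simp: N_def)+
  have s: "0 < s" unfolding i(2) using i(1) xi by (intro divide_pos_pos) (auto simp: N_def)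
  have "0 \<le> coord x j + s * coord d j" if j: "j \<in> I" for j
  proof (cases "coord d j < 0")
    case True
    then have "s \<le> coord x j / - coord d j"
      unfolding s_def using N j by (intro Min_le) (auto simp: Q_def N_def)
    then show ?thesis using True by (simp add: field_simps)
  next
    case False
    then show ?thesis using s P_nonneg[OF x j] by simp
  qed
  then have "x + s *\<^sub>R d \<in> P" using x d by (intro move_in_P null_direction_scaleR) auto
  then show thesis using s i xi by (intro that[of s i]) (auto simp: N_def)
qed

lemma face_at_face_of: "face_at P I x face_of P"
proof -
  have convex: "convex (face_at P I x)"
    using convex_P by (auto simp: convex_def face_at_def)
  have "a \<in> face_at P I x \<and> c \<in> face_at P I x"
    if a: "a \<in> P" and c: "c \<in> P" and y: "y \<in> face_at P I x" "y \<in> open_segment a c" for a c y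
  proof -
    obtain u where u: "0 < u" "u < 1" "y = (1 - u) *\<^sub>R a + u *\<^sub>R c"
      using y by (auto simp: in_segment)
    have "coord a i = 0 \<and> coord c i = 0" if i: "i \<in> I" "coord x i = 0" for i
    proof -
      have "(1 - u) * coord a i + u * coord c i = 0"
        using y(1) u(3) i by (auto simp: face_at_def)
      then show ?thesis
        using P_nonneg[OF a i(1)] P_nonneg[OF c i(1)] u
        by (auto simp: add_nonneg_eq_0_iff)
    qed
    then show ?thesis using a c by (auto simp: face_at_def)
  qed
  moreover have "face_at P I x \<subseteq> P" by (auto simp: face_at_def)
  ultimately show ?thesis using convex unfolding face_of_def by blast
qed

lemma mem_face_at_iff: "y \<in> face_at P I x \<longleftrightarrow> y \<in> P \<and> zeros x \<subseteq> zeros y"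
  by (auto simp: face_at_def)

lemma zeros_add:
  assumes "zeros x \<subseteq> zeros y"
  shows "zeros x \<subseteq> zeros (x + s *\<^sub>R (y - x))" "zeros x \<subseteq> zeros (x + s *\<^sub>R (x - y))"
  using assms by auto

text \<open>A point of the face with the fewest nonzero coordinates in \<open>I\<close> is extreme:
  if it were inside a segment of \<open>P\<close>, moving along that segment's direction up to the
  boundary would create one more zero.\<close>

lemma vertex_exists:
  assumes "x \<in> P"
  obtains v where "v \<in> verts P" "v \<in> face_at P I x"
proof -
  define y where "y = (ARG_MIN (\<lambda>y. card (I - zeros y)) y. y \<in> face_at P I x)"
  have "x \<in> face_at P I x" using assms by (simp add: mem_face_at_iff)
  from arg_min_nat_lemma[of "\<lambda>y. y \<in> face_at P I x", OF this, of "\<lambda>y. card (I - zeros y)"]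
  have y: "y \<in> face_at P I x" "\<And>z. z \<in> face_at P I x \<Longrightarrow> card (I - zeros y) \<le> card (I - zeros z)"
    by (auto simp: y_def)
  have "y extreme_point_of P"
  proof (rule ccontr)
    assume "\<not> y extreme_point_of P"
    then obtain a c where ac: "a \<in> P" "c \<in> P" "y \<in> open_segment a c"
      using y(1) by (auto simp: extreme_point_of_def mem_face_at_iff)
    then have "a \<noteq> c" by auto
    have yP: "y \<in> P" using y(1) by (simp add: mem_face_at_iff)
    then have "y \<in> face_at P I y" by (simp add: mem_face_at_iff)
    then have acF: "a \<in> face_at P I y" "c \<in> face_at P I y"
      using face_at_face_of[of y] ac unfolding face_of_def by blast+
    obtain s i where s: "y + s *\<^sub>R (a - c) \<in> P" "i \<in> I" "coord y i \<noteq> 0" "coord (y + s *\<^sub>R (a - c)) i = 0"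
    proof (rule move_to_boundary[OF yP null_direction_diff[OF ac(1,2)]])
      show "a - c \<noteq> 0" using \<open>a \<noteq> c\<close> by simp
      show "coord (a - c) i = 0" if "i \<in> I" "coord y i = 0" for i
        using acF that by (auto simp: face_at_def)
    qed blast
    have sub: "zeros y \<subseteq> zeros (y + s *\<^sub>R (a - c))"
      using acF by (auto simp: face_at_def)
    then have "I - zeros (y + s *\<^sub>R (a - c)) \<subset> I - zeros y" using s by auto
    then have "card (I - zeros (y + s *\<^sub>R (a - c))) < card (I - zeros y)"
      by (intro psubset_card_mono) auto
    moreover have "y + s *\<^sub>R (a - c) \<in> face_at P I x"
      using sub s(1) y(1) by (auto simp only: mem_face_at_iff)
    ultimately show False using y(2) by (meson not_less)
  qed
  then show thesis using y(1) that by (auto simp: verts_def)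
qed

lemma verts_sub: "verts P \<subseteq> P"
  by (auto simp: verts_def extreme_point_of_def)

lemma self_in_face_at: "x \<in> P \<Longrightarrow> x \<in> face_at P I x"
  by (simp add: mem_face_at_iff)

text \<open>Moving away from a vertex \<open>v\<close> of the face of \<open>x\<close> hits a point with a new vanishing coordinate
  \<open>i\<close>; the vertices of the smaller face all vanish at \<open>i\<close> while \<open>v\<close> does not, which makes the
  collected vertices affinely independent.\<close>

lemma affinely_independent_decomposition:
  assumes "x \<in> P"
  shows "\<exists>S l u. finite S \<and> S \<subseteq> verts P \<and> (\<forall>v\<in>S. 0 < l v) \<and> sum l S = (1::real) \<and>
    (\<Sum>v\<in>S. l v *\<^sub>R v) = x \<and> u \<in> S \<and> independent ((\<lambda>v. v - u) ` (S - {u}))"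
  using assms
proof (induction "card (I - zeros x)" arbitrary: x rule: less_induct)
  case less
  obtain v where v: "v \<in> verts P" "v \<in> face_at P I x" using vertex_exists less.prems by blast
  have vP: "v \<in> P" using v verts_sub by auto
  show ?case
  proof (cases "x = v")
    case True
    show ?thesis
      by (rule exI[of _ "{v}"], rule exI[of _ "\<lambda>_. 1"], rule exI[of _ v]) (use v True independent_empty in auto)
  next
    case False
    have z: "coord (x - v) i = 0" if "i \<in> I" "coord x i = 0" for i
      using v that by (auto simp: face_at_def)
    obtain s i where s: "0 < s" "x + s *\<^sub>R (x - v) \<in> P" "i \<in> I" "coord x i \<noteq> 0"
        "coord (x + s *\<^sub>R (x - v)) i = 0"
    proof (rule move_to_boundary[OF less.prems null_direction_diff[OF less.prems vP]])
      show "x - v \<noteq> 0" using False by simp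
    qed (use z in blast)+
    define y where "y = x + s *\<^sub>R (x - v)"
    have "zeros x \<subseteq> zeros y" unfolding y_def
      using v(2) by (intro zeros_add) (simp add: mem_face_at_iff)
    then have "I - zeros y \<subset> I - zeros x" using s by (auto simp: y_def)
    then have "card (I - zeros y) < card (I - zeros x)" by (intro psubset_card_mono) auto
    then obtain S l u where S: "finite S" "S \<subseteq> verts P" "\<forall>v\<in>S. 0 < l v" "sum l S = (1::real)"
        "(\<Sum>v\<in>S. l v *\<^sub>R v) = y" "u \<in> S" "independent ((\<lambda>v. v - u) ` (S - {u}))"
      using less.hyps[of y] s(2) unfolding y_def by blast
    have "S \<subseteq> face_at P I y"
      using S s(2) verts_sub self_in_face_at[of y]
      by (intro convex_combination_in_face[OF face_at_face_of convex_P, of S l]) (auto simp: y_def)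
    then have Si: "coord w i = 0" if "w \<in> S" for w
      using that s unfolding y_def[symmetric] by (auto simp: face_at_def)
    have vi: "coord v i \<noteq> 0"
    proof
      assume "coord v i = 0"
      then have "(1 + s) * coord x i = 0" using s(5) by (simp add: algebra_simps)
      then show False using s(1,4) by simp
    qed
    have vS: "v \<notin> S" using Si vi by auto
    \<comment> \<open>Solving \<open>y = x + s *\<^sub>R (x - v)\<close> for \<open>x\<close> gives
      the weight \<open>s / (1 + s)\<close> on \<open>v\<close> and \<open>1 / (1 + s)\<close> on
      \<open>y\<close>.\<close>
    define l' where "l' w = (if w = v then s / (1 + s) else l w / (1 + s))" for w
    have sumS: "(\<Sum>w\<in>S. h (l' w) w) = (\<Sum>w\<in>S. h (l w / (1 + s)) w)" for h :: "real \<Rightarrow> fseq \<Rightarrow> 'a::comm_monoid_add"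
      using vS by (intro sum.cong) (auto simp: l'_def)
    have sum_l': "sum l' (insert v S) = 1"
    proof -
      have "sum l' (insert v S) = s / (1 + s) + sum l S / (1 + s)"
        using S(1) vS sumS[of "\<lambda>a _. a"] by (simp add: sum_divide_distrib) (simp add: l'_def)
      also have "\<dots> = 1" using s(1) S(4) by (simp add: field_simps)
      finally show ?thesis .
    qed
    have comb: "(\<Sum>w\<in>insert v S. l' w *\<^sub>R w) = x"
    proof -
      have "(\<Sum>w\<in>insert v S. l' w *\<^sub>R w) = (s / (1 + s)) *\<^sub>R v + (\<Sum>w\<in>S. (l w / (1 + s)) *\<^sub>R w)"
        using S(1) vS sumS[of "\<lambda>a w. a *\<^sub>R w"] by simp (simp add: l'_def)
      also have "(\<Sum>w\<in>S. (l w / (1 + s)) *\<^sub>R w) = (1 / (1 + s)) *\<^sub>R y"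
        by (simp add: S(5)[symmetric] scaleR_sum_right)
      also have "(s / (1 + s)) *\<^sub>R v + (1 / (1 + s)) *\<^sub>R y = x"
      proof -
        have "(s / (1 + s)) *\<^sub>R v + (1 / (1 + s)) *\<^sub>R y = (1 / (1 + s)) *\<^sub>R (s *\<^sub>R v + y)"
          by (simp add: scaleR_add_right)
        also have "s *\<^sub>R v + y = (1 + s) *\<^sub>R x" by (simp add: y_def algebra_simps)
        finally show ?thesis using s(1) by simp
      qed
      finally show ?thesis .
    qed
    have ind: "independent ((\<lambda>w. w - u) ` (insert v S - {u}))"
    proof -
      \<comment> \<open>The differences within \<open>S\<close> span a subspace of the hyperplane
        where coordinate \<open>i\<close> vanishes, and \<open>v - u\<close> is outside of
        it.\<close>
      have "span ((\<lambda>w. w - u) ` (S - {u})) \<subseteq> {w. coord w i = 0}"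
        using Si S(6) by (intro span_minimal) (auto simp: subspace_def)
      then have "v - u \<notin> span ((\<lambda>w. w - u) ` (S - {u}))"
        using vi Si[OF S(6)] by auto
      moreover have "(\<lambda>w. w - u) ` (insert v S - {u}) = insert (v - u) ((\<lambda>w. w - u) ` (S - {u}))"
        using vS S(6) by auto
      ultimately show ?thesis using S(7) by (simp add: independent_insert)
    qed
    show ?thesis
      by (rule exI[of _ "insert v S"], rule exI[of _ l'], rule exI[of _ u])
        (use S v s(1) sum_l' comb ind in \<open>auto simp: l'_def\<close>)
  qed
qed

lemma face_at_vertex_decomposition:
  assumes "x \<in> P" "x \<in> face_at P I z"
  obtains S l where "finite S" "S \<subseteq> verts P \<inter> face_at P I z" "\<And>v. v \<in> S \<Longrightarrow> 0 < l v"
    "sum l S = (1::real)" "(\<Sum>v\<in>S. l v *\<^sub>R v) = x"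
proof -
  obtain S l u where S: "finite S" "S \<subseteq> verts P" "\<forall>v\<in>S. 0 < l v" "sum l S = (1::real)"
        "(\<Sum>v\<in>S. l v *\<^sub>R v) = x"
    using affinely_independent_decomposition[OF assms(1)] by blast
  have "S \<subseteq> face_at P I z"
    using S assms verts_sub
    by (intro convex_combination_in_face[OF face_at_face_of convex_P, of S l]) auto
  with S show thesis by (intro that[of S l]) auto
qed

text \<open>A point of the face is a convex combination of vertices of the same face. Through this
  lemma the oracle answers, optimal among vertices, compare with arbitrary points of the
  face.\<close>

lemma linear_le_on_face:
  assumes "\<And>v. v \<in> verts P \<inter> face_at P I z \<Longrightarrow> v \<bullet> c \<le> M" "x \<in> face_at P I z"
  shows "x \<bullet> c \<le> M"
proof -
  have "x \<in> P" using assms by (simp add: mem_face_at_iff)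
  from face_at_vertex_decomposition[OF this assms(2)] obtain S l where
    S: "finite S" "S \<subseteq> verts P \<inter> face_at P I z" "\<And>v. v \<in> S \<Longrightarrow> 0 < l v"
    "sum l S = (1::real)" "(\<Sum>v\<in>S. l v *\<^sub>R v) = x" by blast
  have "x \<bullet> c = (\<Sum>v\<in>S. l v * (v \<bullet> c))" by (simp add: S(5)[symmetric] inner_sum_left)
  also have "\<dots> \<le> (\<Sum>v\<in>S. l v * M)"
    using S assms(1) by (intro sum_mono mult_left_mono) (auto intro: less_imp_le)
  also have "\<dots> = M" using S(4) by (simp add: sum_distrib_right[symmetric])
  finally show ?thesis .
qed

text \<open>A vertex is determined by its zero set: if \<open>v\<close> and \<open>w\<close> had the
  same zeros, one could pass from \<open>w\<close> through \<open>v\<close> and a little further to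
  a point \<open>u\<close> of \<open>P\<close>, and \<open>v\<close> would lie strictly between
  \<open>u\<close> and \<open>w\<close>.\<close>

lemma finite_verts: "finite (verts P)"
proof (rule inj_on_finite[of zeros])
  show "inj_on zeros (verts P)"
  proof (rule inj_onI, rule ccontr)
    fix v w assume vw: "v \<in> verts P" "w \<in> verts P" "zeros v = zeros w" "v \<noteq> w"
    then have P: "v \<in> P" "w \<in> P" using verts_sub by auto
    have z: "coord (v - w) i = 0 \<and> coord (w - v) i = 0" if "i \<in> I" "coord v i = 0" for i
      using vw(3) that by auto
    obtain s where s: "0 < s" "v + s *\<^sub>R (v - w) \<in> P"
    proof (rule move_to_boundary[OF P(1) null_direction_diff[OF P(1,2)]])
      show "v - w \<noteq> 0" using vw(4) by simp
    qed (use z in blast)+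
    define u where "u = v + s *\<^sub>R (v - w)"
    have "(1 + s) *\<^sub>R v = u + s *\<^sub>R w" by (simp add: u_def algebra_simps)
    then have "v = (1 / (1 + s)) *\<^sub>R (u + s *\<^sub>R w)" using s(1)
      by (metis add_pos_pos divide_inverse less_irrefl mult_1 scaleR_one scaleR_scaleR left_inverse zero_less_one)
    moreover have "1 / (1 + s) = 1 - s / (1 + s)" using s(1) by (simp add: field_simps)
    ultimately have "v = (1 - s / (1 + s)) *\<^sub>R u + (s / (1 + s)) *\<^sub>R w"
      by (metis (no_types, lifting) divide_inverse mult.commute mult_1 scaleR_add_right scaleR_scaleR)
    moreover have "u \<noteq> w"
    proof
      assume "u = w"
      then have "(1 + s) *\<^sub>R (v - w) = 0" by (simp add: u_def algebra_simps)
      then show False using s(1) vw(4) by simp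
    qed
    ultimately have "v \<in> open_segment u w"
      unfolding in_segment using s(1) by (intro conjI exI[of _ "s / (1 + s)"]) auto
    then show False using vw(1) s(2) P by (auto simp: verts_def extreme_point_of_def u_def)
  qed
  show "zeros ` verts P \<subseteq> Pow I" by auto
qed simp

lemma compact_P: "compact P"
proof -
  have "P = convex hull (verts P)"
  proof
    show "convex hull (verts P) \<subseteq> P" using verts_sub convex_P by (rule hull_minimal)
    show "P \<subseteq> convex hull (verts P)"
    proof
      fix x assume x: "x \<in> P"
      from face_at_vertex_decomposition[OF this self_in_face_at[OF x]] obtain S l where
        S: "finite S" "S \<subseteq> verts P \<inter> face_at P I x" "\<And>v. v \<in> S \<Longrightarrow> 0 < l v"
        "sum l S = (1::real)" "(\<Sum>v\<in>S. l v *\<^sub>R v) = x" by blast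
      have "(\<Sum>v\<in>S. l v *\<^sub>R v) \<in> convex hull (verts P)"
        using S by (intro convex_sum) (auto intro: hull_inc less_imp_le)
      then show "x \<in> convex hull (verts P)" using S by simp
    qed
  qed
  then show ?thesis using finite_imp_compact_convex_hull[OF finite_verts] by simp
qed

text \<open>A nonzero difference of two points would need a negative coordinate in
  \<open>I\<close>.\<close>

lemma singleton_if_no_constraints:
  assumes "I = {}" "x \<in> P" "y \<in> P"
  shows "x = y"
  using null_direction_neg_coord[OF assms(2) null_direction_diff[OF assms(2,3)]] assms(1) by auto

end

section \<open>Gradient inequalities and mass transport between points of a face\<close>

lemma line_derivative:
  assumes g: "gradient_on n f g" and x: "x \<in> Rn n" and d: "d \<in> Rn n"
  shows "((\<lambda>s. f (x + s *\<^sub>R d)) has_real_derivative (d \<bullet> g (x + s *\<^sub>R d))) (at s)"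
proof -
  have "(f has_derivative (\<lambda>h. g (x + s *\<^sub>R d) \<bullet> h)) (at (x + s *\<^sub>R d) within Rn n)"
    using assms by (simp add: gradient_on_def)
  then have f: "(f has_derivative (\<lambda>h. g (x + s *\<^sub>R d) \<bullet> h))
      (at (x + s *\<^sub>R d) within range (\<lambda>s. x + s *\<^sub>R d))"
    by (rule has_derivative_subset) (use x d in auto)
  have "((\<lambda>s. x + s *\<^sub>R d) has_derivative (\<lambda>h. h *\<^sub>R d)) (at s)"
    by (auto intro!: derivative_eq_intros)
  from has_derivative_in_compose[OF this f] show ?thesis
    by (simp add: has_field_derivative_def inner_commute mult.commute[of _ "d \<bullet> _"])
qed

lemma convex_on_line:
  assumes "convex_on (Rn n) f" "x \<in> Rn n" "d \<in> Rn n"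
  shows "convex_on UNIV (\<lambda>s. f (x + s *\<^sub>R d))"
proof (rule convex_onI)
  fix t a c :: real assume t: "0 < t" "t < 1"
  have "x + ((1 - t) *\<^sub>R a + t *\<^sub>R c) *\<^sub>R d = (1 - t) *\<^sub>R (x + a *\<^sub>R d) + t *\<^sub>R (x + c *\<^sub>R d)"
    by (simp add: algebra_simps)
  then show "f (x + ((1 - t) *\<^sub>R a + t *\<^sub>R c) *\<^sub>R d) \<le> (1 - t) * f (x + a *\<^sub>R d) + t * f (x + c *\<^sub>R d)"
    using convex_onD[OF assms(1), of t "x + a *\<^sub>R d" "x + c *\<^sub>R d"] t assms by simp
qed simp

lemma gradient_inequality:
  assumes "convex_on (Rn n) f" "gradient_on n f g" "x \<in> Rn n" "y \<in> Rn n"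
  shows "f x - f y \<le> (x - y) \<bullet> g x"
proof -
  have d: "y - x \<in> Rn n" using assms by simp
  have "f (x + 1 *\<^sub>R (y - x)) - f (x + 0 *\<^sub>R (y - x)) \<ge> ((y - x) \<bullet> g (x + 0 *\<^sub>R (y - x))) * (1 - 0)"
    using convex_on_line[OF assms(1,3) d]
      line_derivative[OF assms(2,3) d, of 0]
    by (intro convex_on_imp_above_tangent[where A = UNIV]) auto
  then show ?thesis by (simp add: algebra_simps)
qed

text \<open>The function \<open>\<psi>\<close>, the difference between \<open>f\<close> on the ray
  and its quadratic model, has nonpositive derivative by the Lipschitz bound.\<close>

lemma smoothness_inequality:
  assumes g: "gradient_on n f g" and \<beta>: "\<beta>-lipschitz_on (Rn n) g" and x: "x \<in> Rn n" and d: "d \<in> Rn n"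
    and s: "0 \<le> s"
  shows "f (x + s *\<^sub>R d) \<le> f x + s * (d \<bullet> g x) + s\<^sup>2 * (\<beta> * (norm d)\<^sup>2) / 2"
proof -
  define \<psi> where "\<psi> t = f (x + t *\<^sub>R d) - t * (d \<bullet> g x) - t\<^sup>2 * (\<beta> * (norm d)\<^sup>2) / 2" for t
  have "\<psi> s \<le> \<psi> 0"
  proof (rule DERIV_nonpos_imp_nonincreasing[OF s])
    fix t assume t: "0 \<le> t" "t \<le> s"
    have "(\<psi> has_real_derivative d \<bullet> g (x + t *\<^sub>R d) - d \<bullet> g x - t * (\<beta> * (norm d)\<^sup>2)) (at t)"
      unfolding \<psi>_def using line_derivative[OF g x d, of t]
      by (auto intro!: derivative_eq_intros)
    moreover have "d \<bullet> g (x + t *\<^sub>R d) - d \<bullet> g x - t * (\<beta> * (norm d)\<^sup>2) \<le> 0"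
    proof -
      have "d \<bullet> g (x + t *\<^sub>R d) - d \<bullet> g x = d \<bullet> (g (x + t *\<^sub>R d) - g x)"
        by (simp add: inner_diff_right)
      also have "\<dots> \<le> norm d * norm (g (x + t *\<^sub>R d) - g x)" by (rule norm_cauchy_schwarz)
      also have "\<dots> \<le> norm d * (\<beta> * norm (t *\<^sub>R d))"
        using lipschitz_onD[OF \<beta>, of "x + t *\<^sub>R d" x] x d
        by (intro mult_left_mono) (auto simp: dist_norm)
      also have "\<dots> = t * (\<beta> * (norm d)\<^sup>2)" using t by (simp add: power2_eq_square)
      finally show ?thesis by simp
    qed
    ultimately show "\<exists>y. (\<psi> has_real_derivative y) (at t) \<and> y \<le> 0" by blast
  qed
  then show ?thesis by (simp add: \<psi>_def)
qed

context bounded_polyhedron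
begin

text \<open>The tight coordinates of \<open>greedy_weights\<close> cover the removed mass, and at a tight
  coordinate \<open>y - x\<close> is at least the removed mass of the vertices it covers, by the slack assumption.
  Cauchy--Schwarz over a cover of size at most \<open>card S\<close> bounds the total removed mass.\<close>

lemma transport_bound:
  assumes slack: "\<And>v i. v \<in> verts P \<Longrightarrow> i \<in> I \<Longrightarrow> coord v i = 0 \<or> 1 \<le> coord v i"
    and x: "x \<in> P" and y: "y \<in> face_at P I x"
    and S: "finite S" "S \<subseteq> verts P" "\<And>v. v \<in> S \<Longrightarrow> 0 < l v" "sum l S = (1::real)"
      "(\<Sum>v\<in>S. l v *\<^sub>R v) = y"
    and lo: "\<And>v. v \<in> face_at P I x \<Longrightarrow> lo \<le> v \<bullet> c"
    and hi: "\<And>v. v \<in> face_at P I x \<Longrightarrow> v \<bullet> c \<le> hi"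
  shows "(x - y) \<bullet> c \<le> sqrt (card S) * dist x y * (hi - lo)"
proof -
  have SP: "S \<subseteq> P" using S verts_sub by blast
  have Snn: "0 \<le> coord v i" if "v \<in> S" "i \<in> I" for v i using SP P_nonneg that by blast
  have SF: "S \<subseteq> face_at P I x"
    using S y SP by (intro convex_combination_in_face[OF face_at_face_of convex_P, of S l]) auto
  have yP: "y \<in> P" using y by (simp add: mem_face_at_iff)
  obtain \<mu> where \<mu>: "\<forall>v\<in>S. 0 \<le> \<mu> v \<and> \<mu> v \<le> l v"
    "\<forall>i\<in>I. (\<Sum>v\<in>S. \<mu> v * coord v i) \<le> coord x i"
    "\<forall>v\<in>S. \<mu> v < l v \<longrightarrow> (\<exists>i\<in>I. 0 < coord v i \<and> (\<Sum>v\<in>S. \<mu> v * coord v i) = coord x i)"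
    using greedy_weights[of S I l x] S Snn P_nonneg[OF x] by (auto simp: less_imp_le)
  define \<delta> where "\<delta> v = l v - \<mu> v" for v
  have \<delta>: "0 \<le> \<delta> v" if "v \<in> S" for v using \<mu>(1) that by (simp add: \<delta>_def)
  define T where "T = {v \<in> S. \<mu> v < l v}"
  have T: "finite T" "T \<subseteq> S" using S by (auto simp: T_def)
  have "\<forall>v\<in>T. \<exists>i. i \<in> I \<and> 0 < coord v i \<and> (\<Sum>v\<in>S. \<mu> v * coord v i) = coord x i"
    using \<mu>(3) unfolding T_def by blast
  then obtain t where t: "\<forall>v\<in>T. t v \<in> I \<and> 0 < coord v (t v) \<and> (\<Sum>u\<in>S. \<mu> u * coord u (t v)) = coord x (t v)"
    by (auto dest!: bchoice)
  have y_coord: "coord y i = (\<Sum>v\<in>S. l v * coord v i)" for i by (simp add: S(5)[symmetric])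
  have diff: "coord y i - coord x i = (\<Sum>v\<in>S. \<delta> v * coord v i)" if "i \<in> t ` T" for i
    using t that unfolding y_coord \<delta>_def by (auto simp: algebra_simps sum_subtractf)
  have tI: "t ` T \<subseteq> I" using t by auto
  have mass: "sum \<delta> S \<le> sqrt (card S) * dist x y"
  proof -
    have "sum \<delta> S = sum \<delta> T"
      using \<mu>(1) S by (intro sum.mono_neutral_right) (auto simp: T_def \<delta>_def intro: antisym)
    also have "\<dots> \<le> (\<Sum>v\<in>T. \<delta> v * (\<Sum>i\<in>t ` T. coord v i))"
    proof (rule sum_mono)
      fix v assume v: "v \<in> T"
      have "1 \<le> coord v (t v)" using slack[of v "t v"] t v T S(2) by fastforce
      also have "\<dots> \<le> (\<Sum>i\<in>t ` T. coord v i)"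
        using v T tI Snn by (intro member_le_sum) auto
      finally have "\<delta> v * 1 \<le> \<delta> v * (\<Sum>i\<in>t ` T. coord v i)"
        using v T \<delta> by (intro mult_left_mono) auto
      then show "\<delta> v \<le> \<delta> v * (\<Sum>i\<in>t ` T. coord v i)" by simp
    qed
    \<comment> \<open>Enlarging \<open>T\<close> to \<open>S\<close> adds nonnegative terms. Only
      with all of \<open>S\<close> does the sum at a tight coordinate equal the difference of
      \<open>y\<close> and \<open>x\<close>.\<close>
    also have "\<dots> \<le> (\<Sum>v\<in>S. \<delta> v * (\<Sum>i\<in>t ` T. coord v i))"
      using S T tI Snn \<delta> by (intro sum_mono2 mult_nonneg_nonneg sum_nonneg) auto
    also have "\<dots> = (\<Sum>i\<in>t ` T. coord y i - coord x i)"
      by (simp add: diff sum_distrib_left sum.swap[of _ S])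
    finally have le: "sum \<delta> S \<le> (\<Sum>i\<in>t ` T. coord y i - coord x i)" .
    have "(\<Sum>i\<in>t ` T. coord y i - coord x i)\<^sup>2 \<le> (\<Sum>i\<in>t ` T. (coord y i - coord x i)\<^sup>2) * card (t ` T)"
      by (rule sum_squared_le_sum_of_squares)
    also have "\<dots> \<le> (\<Sum>i<n. (coord (x - y) i)\<^sup>2) * card S"
    proof (intro mult_mono)
      show "(\<Sum>i\<in>t ` T. (coord y i - coord x i)\<^sup>2) \<le> (\<Sum>i<n. (coord (x - y) i)\<^sup>2)"
        using T tI I_sub by (subst power2_commute) (auto intro!: sum_mono2)
      show "real (card (t ` T)) \<le> real (card S)"
        using card_image_le[of T t] card_mono[of S T] T S by simp
    qed (auto intro: sum_nonneg)
    also have "(\<Sum>i<n. (coord (x - y) i)\<^sup>2) = (dist x y)\<^sup>2"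
      using norm_Rn[OF Rn_diff[OF P_sub_Rn[OF x] P_sub_Rn[OF yP]]]
      by (simp add: dist_norm L2_set_def sum_nonneg)
    also have "(dist x y)\<^sup>2 * card S = (sqrt (card S) * dist x y)\<^sup>2" by (simp add: power_mult_distrib)
    finally have "(\<Sum>i\<in>t ` T. coord y i - coord x i) \<le> sqrt (card S) * dist x y"
      by (rule power2_le_imp_le) simp
    with le show ?thesis by simp
  qed
  have xy: "x - y = (x - (\<Sum>v\<in>S. \<mu> v *\<^sub>R v)) - (\<Sum>v\<in>S. \<delta> v *\<^sub>R v)"
    by (simp add: S(5)[symmetric] \<delta>_def scaleR_diff_left sum_subtractf)
  have "(x - y) \<bullet> c \<le> sum \<delta> S * (hi - lo)"
  \<comment> \<open>If no mass is removed, \<open>x\<close> dominates \<open>y\<close> on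
    \<open>I\<close>; then \<open>x - y\<close> is a null direction without negative coordinate,
    hence zero.\<close>
  proof (cases "sum \<delta> S = 0")
    case True
    then have "\<forall>v\<in>S. \<delta> v = 0" using S \<delta> by (simp add: sum_nonneg_eq_0_iff)
    then have l: "\<forall>v\<in>S. \<mu> v = l v" by (simp add: \<delta>_def)
    have "\<forall>i\<in>I. 0 \<le> coord (x - y) i" using \<mu>(2) l by (simp add: y_coord)
    then have "x - y = 0"
      using null_direction_neg_coord[OF x null_direction_diff[OF x yP]] by (metis not_less)
    then show ?thesis using True by simp
  next
    case False
    then have pos: "0 < sum \<delta> S" using \<delta> sum_nonneg[of S \<delta>] by (auto simp: less_le)
    define r where "r = x - (\<Sum>v\<in>S. \<mu> v *\<^sub>R v)"
    have mu: "sum \<mu> S = 1 - sum \<delta> S" using S(4) by (simp add: \<delta>_def sum_subtractf)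
    \<comment> \<open>The rest of \<open>x\<close> beyond the kept mass, rescaled to total mass 1,
      is again a point of the face. So \<open>x - y\<close> moves the removed mass from vertices of
      the face to \<open>z\<close>, and each unit of it changes the functional by at most
      \<open>hi - lo\<close>.\<close>
    define z where "z = (1 / sum \<delta> S) *\<^sub>R r"
    have zP: "z \<in> P"
    proof -
      have "(\<Sum>j<n. A k j * coord z j) = b k" if k: "k < m" for k
      proof -
        have bk: "(\<Sum>j<n. A k j * coord w j) = b k" if "w \<in> P" for w
          using that k by (simp add: P_eq polyhedron_of_def)
        have "(\<Sum>j<n. A k j * coord r j) = b k - (\<Sum>j<n. A k j * (\<Sum>v\<in>S. \<mu> v * coord v j))"
          using bk[OF x] by (simp add: r_def right_diff_distrib sum_subtractf)
        also have "(\<Sum>j<n. A k j * (\<Sum>v\<in>S. \<mu> v * coord v j)) = (\<Sum>v\<in>S. \<mu> v * (\<Sum>j<n. A k j * coord v j))"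
          by (simp add: sum_distrib_left sum.swap[of _ S] mult.left_commute)
        also have "\<dots> = (\<Sum>v\<in>S. \<mu> v * b k)" using bk SP by (intro sum.cong) auto
        also have "\<dots> = (1 - sum \<delta> S) * b k" by (simp add: sum_distrib_right[symmetric] mu)
        finally have "(\<Sum>j<n. A k j * coord r j) = sum \<delta> S * b k" by (simp add: algebra_simps)
        then show ?thesis using pos
          by (simp add: z_def sum_divide_distrib[symmetric])
      qed
      moreover have "0 \<le> coord z i" if "i \<in> I" for i
        using \<mu>(2) that pos by (simp add: z_def r_def)
      moreover have "z \<in> Rn n"
        using P_sub_Rn[OF x] SP P_sub_Rn unfolding z_def r_def
        by (intro Rn_scaleR Rn_diff subspace_sum[OF subspace_Rn]) auto
      ultimately show ?thesis by (simp add: P_eq polyhedron_of_def)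
    qed
    have "z \<in> face_at P I x"
      using zP SF by (auto simp: mem_face_at_iff z_def r_def face_at_def subset_iff intro!: sum.neutral)
    then have zhi: "z \<bullet> c \<le> hi" by (rule hi)
    have "(x - y) \<bullet> c = sum \<delta> S * (z \<bullet> c) - (\<Sum>v\<in>S. \<delta> v * (v \<bullet> c))"
      using pos by (simp add: xy z_def r_def inner_diff_left inner_sum_left)
    also have "\<dots> \<le> sum \<delta> S * hi - (\<Sum>v\<in>S. \<delta> v * lo)"
      using pos zhi \<delta> lo SF by (intro diff_mono mult_left_mono sum_mono) auto
    also have "\<dots> = sum \<delta> S * (hi - lo)" by (simp add: sum_distrib_right right_diff_distrib)
    finally show ?thesis .
  qed
  also have "\<dots> \<le> sqrt (card S) * dist x y * (hi - lo)"
    using mass lo[OF self_in_face_at[OF x]] hi[OF self_in_face_at[OF x]]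
    by (intro mult_right_mono) auto
  finally show ?thesis .
qed

end

section \<open>Conditional gradient steps\<close>

locale smooth_convex_problem = bounded_polyhedron +
  fixes f :: "fseq \<Rightarrow> real" and g :: "fseq \<Rightarrow> fseq" and \<beta> :: real
  assumes P_ne: "P \<noteq> {}" and convex_f: "convex_on (Rn n) f" and gradient_f: "gradient_on n f g"
    and lipschitz_g: "\<beta>-lipschitz_on (Rn n) g"
begin

abbreviation "fmin \<equiv> min_value f P"
abbreviation "curv \<equiv> \<beta> * (diameter P)\<^sup>2"

lemma curv_nonneg: "0 \<le> curv"
  using lipschitz_on_nonneg[OF lipschitz_g] by simp

lemma minimizers_eq: "minimizers f P = {x \<in> P. f x = fmin}"
  and minimizers_ne: "minimizers f P \<noteq> {}"
  and fmin_le: "x \<in> P \<Longrightarrow> fmin \<le> f x"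
proof -
  have "continuous_on (Rn n) f"
    using gradient_f unfolding gradient_on_def
    by (intro has_derivative_continuous_on[of "Rn n" f "\<lambda>x h. g x \<bullet> h"]) auto
  then have "continuous_on P f" using P_sub_Rn by (auto intro: continuous_on_subset)
  then obtain z where z: "z \<in> P" "\<forall>y\<in>P. f z \<le> f y"
    using continuous_attains_inf[OF compact_P P_ne] by blast
  have m: "fmin = f z"
    unfolding min_value_def using z by (intro cInf_eq_minimum) auto
  show eq: "minimizers f P = {x \<in> P. f x = fmin}"
    unfolding m minimizers_def is_arg_min_def using z
    by (auto simp: not_less intro: antisym)
  show "minimizers f P \<noteq> {}" using z unfolding eq m by auto
  show "x \<in> P \<Longrightarrow> fmin \<le> f x" using z m by simp
qed

lemma mem_minimizersD: "y \<in> minimizers f P \<Longrightarrow> y \<in> P \<and> f y = fmin"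
  by (simp add: minimizers_eq)

lemma norm_diff_le_diameter: "x \<in> P \<Longrightarrow> y \<in> P \<Longrightarrow> norm (x - y) \<le> diameter P"
  using diameter_bounded_bound[OF bounded_P] by (metis dist_norm)

text \<open>The direction is the difference of two arbitrary points of \<open>P\<close> to serve
  both toward steps and away steps; \<open>s\<close> may exceed 1 and the new point may lie outside
  \<open>P\<close>.\<close>

lemma descent:
  assumes "x \<in> P" "y \<in> P" "z \<in> P" "0 \<le> s"
  shows "f (x + s *\<^sub>R (y - z)) \<le> f x + s * ((y - z) \<bullet> g x) + s\<^sup>2 * curv / 2"
proof -
  have "f (x + s *\<^sub>R (y - z)) \<le> f x + s * ((y - z) \<bullet> g x) + s\<^sup>2 * (\<beta> * (norm (y - z))\<^sup>2) / 2"
    using assms P_sub_Rn by (intro smoothness_inequality[OF gradient_f lipschitz_g]) auto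
  also have "s\<^sup>2 * (\<beta> * (norm (y - z))\<^sup>2) \<le> s\<^sup>2 * curv"
    using norm_diff_le_diameter[OF assms(2,3)] lipschitz_on_nonneg[OF lipschitz_g]
    by (intro mult_left_mono power_mono) auto
  finally show ?thesis by simp
qed

lemma primal_gap_le:
  assumes "x \<in> P" "y \<in> minimizers f P"
  shows "f x - fmin \<le> (x - y) \<bullet> g x"
proof -
  have "y \<in> P" "f y = fmin" using mem_minimizersD assms by auto
  then show ?thesis using gradient_inequality[OF convex_f gradient_f, of x y] assms P_sub_Rn by simp
qed

lemma line_searchD:
  assumes "exact_line_search f x d \<gamma> \<eta>"
  shows "0 \<le> \<eta>" "\<eta> \<le> \<gamma>" "0 \<le> s \<Longrightarrow> s \<le> \<gamma> \<Longrightarrow> f (x + \<eta> *\<^sub>R d) \<le> f (x + s *\<^sub>R d)"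
  using assms by (auto simp: exact_line_search_def is_arg_min_linorder)

lemma segment_in_P:
  assumes "x \<in> P" "v \<in> P" "0 \<le> s" "s \<le> 1"
  shows "x + s *\<^sub>R (v - x) \<in> P"
proof -
  have "(1 - s) *\<^sub>R x + s *\<^sub>R v \<in> P" using assms convex_P by (intro convexD) auto
  then show ?thesis by (simp add: algebra_simps)
qed

lemma cg_step_decrease:
  assumes x: "x \<in> P" and step: "cg_step f g P x x'"
  shows "x' \<in> P" "f x' \<le> f x"
    "0 \<le> s \<Longrightarrow> s \<le> 1 \<Longrightarrow> f x' - fmin \<le> (1 - s) * (f x - fmin) + s\<^sup>2 * curv / 2"
proof -
  obtain v \<eta> where v: "is_arg_min (\<lambda>v. v \<bullet> g x) (\<lambda>v. v \<in> verts P) v"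
    and \<eta>: "exact_line_search f x (v - x) 1 \<eta>" and x': "x' = x + \<eta> *\<^sub>R (v - x)"
    using step by (auto simp: cg_step_def)
  have vP: "v \<in> P" using v verts_sub by (auto simp: is_arg_min_def)
  show "x' \<in> P" unfolding x' using x vP line_searchD(1,2)[OF \<eta>] by (rule segment_in_P)
  show "f x' \<le> f x" unfolding x' using line_searchD(3)[OF \<eta>, of 0] by simp
  assume s: "0 \<le> s" "s \<le> 1"
  obtain y where y: "y \<in> minimizers f P" using minimizers_ne by auto
  then have yP: "y \<in> P" using mem_minimizersD by blast
  have "y \<bullet> (- g x) \<le> - (v \<bullet> g x)"
  proof (rule linear_le_on_face[OF _ self_in_face_at[OF yP]])
    show "u \<bullet> (- g x) \<le> - (v \<bullet> g x)" if "u \<in> verts P \<inter> face_at P I y" for u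
      using v that by (simp add: is_arg_min_linorder)
  qed
  then have "(v - x) \<bullet> g x \<le> - (f x - fmin)"
    using primal_gap_le[OF x y] by (simp add: inner_diff_left)
  then have "s * ((v - x) \<bullet> g x) \<le> s * (- (f x - fmin))" using s by (intro mult_left_mono)
  moreover have "f x' \<le> f x + s * ((v - x) \<bullet> g x) + s\<^sup>2 * curv / 2"
    unfolding x' using line_searchD(3)[OF \<eta>, OF s] descent[OF x vP x s(1)] by linarith
  ultimately show "f x' - fmin \<le> (1 - s) * (f x - fmin) + s\<^sup>2 * curv / 2"
    by (simp add: algebra_simps)
qed

text \<open>Exact line search is at least as good as any prescribed step size. The step size 1 in
  the first step makes the rate independent of the starting gap, which matters because every phase
  restarts the count.\<close>

lemma cg_trace_rate:
  assumes tr: "cg_trace f g P K xs" and x: "hd xs \<in> P" and j: "j \<le> K"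
  shows "xs ! j \<in> P" "1 \<le> j \<Longrightarrow> f (xs ! j) - fmin \<le> 2 * curv / (real j + 1)"
proof -
  have step: "cg_step f g P (xs ! j) (xs ! Suc j)" if "j < K" for j
    using tr that by (simp add: cg_trace_def)
  have "xs \<noteq> []" using tr by (auto simp: cg_trace_def)
  then have x0: "xs ! 0 \<in> P" using x by (simp add: hd_conv_nth)
  have P: "xs ! j \<in> P" if "j \<le> K" for j
    using that by (induction j) (use x0 cg_step_decrease(1) step in auto)
  show "xs ! j \<in> P" using P j .
  show "f (xs ! j) - fmin \<le> 2 * curv / (real j + 1)" if "1 \<le> j"
    using that j
  proof (induction j rule: dec_induct)
    case base
    then have "f (xs ! 1) - fmin \<le> (1 - 1) * (f (xs ! 0) - fmin) + 1\<^sup>2 * curv / 2"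
      using cg_step_decrease(3)[OF x0, of "xs ! 1" 1] step[of 0] by simp
    then show ?case using curv_nonneg by simp
  next
    case (step j)
    define B where "B = curv"
    define a where "a = real j"
    have a: "1 \<le> a" using step.hyps by (simp add: a_def)
    have B: "0 \<le> B" using curv_nonneg by (simp add: B_def)
    \<comment> \<open>The comparison step size is 2 / (j + 2), the usual open-loop choice.\<close>
    have "f (xs ! Suc j) - fmin \<le> (1 - 2 / (a + 2)) * (f (xs ! j) - fmin) + (2 / (a + 2))\<^sup>2 * B / 2"
      unfolding B_def using step.prems a \<open>\<And>j. j < K \<Longrightarrow> cg_step f g P (xs ! j) (xs ! Suc j)\<close>
      by (intro cg_step_decrease(3) P) auto
    also have "\<dots> \<le> (1 - 2 / (a + 2)) * (2 * B / (a + 1)) + (2 / (a + 2))\<^sup>2 * B / 2"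
      using step.IH step.prems a by (intro add_right_mono mult_left_mono) (auto simp: a_def B_def)
    also have "\<dots> = 2 * B / (a + 2) * (a / (a + 1) + 1 / (a + 2))"
      using a by (simp add: divide_simps power2_eq_square) (simp add: algebra_simps)
    also have "\<dots> \<le> 2 * B / (a + 2) * 1"
    proof (intro mult_left_mono)
      have "1 / (a + 2) \<le> 1 / (a + 1)" using a by (intro frac_le) auto
      moreover have "a / (a + 1) = 1 - 1 / (a + 1)" using a by (simp add: field_simps)
      ultimately show "a / (a + 1) + 1 / (a + 2) \<le> 1" by linarith
    qed (use a B in simp)
    finally show ?case by (simp add: B_def a_def add.commute)
  qed
qed

section \<open>Feasibility and line search in a face-monotone step\<close>

lemma fm_step_basic:
  assumes x: "x \<in> P" and step: "fm_step f g P I x x'"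
  shows "x' \<in> P" "zeros x \<subseteq> zeros x'" "f x' \<le> f x"
proof -
  obtain v w where v: "toward_vertex g P I x v" and w: "away_vertex g P I x w"
    and alt: "if (x - v) \<bullet> g x > (w - x) \<bullet> g x
       then \<exists>\<eta>. exact_line_search f x (v - x) 1 \<eta> \<and> x' = x + \<eta> *\<^sub>R (v - x)
       else \<exists>\<gamma> \<eta>. max_away_step I x w \<gamma> \<and> exact_line_search f x (x - w) \<gamma> \<eta> \<and> x' = x + \<eta> *\<^sub>R (x - w)"
    using step unfolding fm_step_def by blast
  have vF: "v \<in> P" "zeros x \<subseteq> zeros v" and wF: "w \<in> P" "zeros x \<subseteq> zeros w"
    using v w by (auto simp: toward_vertex_def away_vertex_def is_arg_min_def is_arg_max_def face_at_def)
  have "x' \<in> P \<and> zeros x \<subseteq> zeros x' \<and> f x' \<le> f x"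
  proof (cases "(x - v) \<bullet> g x > (w - x) \<bullet> g x")
    case True
    then obtain \<eta> where \<eta>: "exact_line_search f x (v - x) 1 \<eta>" and x': "x' = x + \<eta> *\<^sub>R (v - x)"
      using alt by auto
    show ?thesis unfolding x'
      using segment_in_P[OF x vF(1) line_searchD(1,2)[OF \<eta>]] line_searchD(3)[OF \<eta>, of 0]
        zeros_add(1)[OF vF(2)] by simp
  next
    case False
    then obtain \<gamma> \<eta> where \<gamma>: "max_away_step I x w \<gamma>" and \<eta>: "exact_line_search f x (x - w) \<gamma> \<eta>"
      and x': "x' = x + \<eta> *\<^sub>R (x - w)"
      using alt by auto
    \<comment> \<open>The coordinate is affine in the step size and nonnegative at both ends 0 and
      \<open>\<gamma>\<close>, hence also at \<open>\<eta>\<close>.\<close>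
    have nn: "0 \<le> coord x i + \<eta> * (coord x i - coord w i)" if i: "i \<in> I" for i
    proof -
      have "0 \<le> coord x i + \<gamma> * (coord x i - coord w i)"
        using \<gamma> i by (auto simp: max_away_step_def is_arg_max_def)
      moreover have "0 \<le> coord x i" using P_nonneg x i by blast
      moreover have "\<gamma> * z \<le> \<eta> * z \<or> 0 \<le> \<eta> * z" for z
        using line_searchD(1,2)[OF \<eta>] by (cases "z \<le> 0") (auto intro: mult_right_mono_neg)
      ultimately show ?thesis by (smt (verit))
    qed
    have "x' \<in> P" unfolding x'
      using x nn null_direction_diff[OF x wF(1)] by (intro move_in_P null_direction_scaleR) auto
    then show ?thesis
      using line_searchD(1,2)[OF \<eta>] line_searchD(3)[OF \<eta>, of 0] zeros_add(2)[OF wF(2)] by (simp add: x')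
  qed
  then show "x' \<in> P" "zeros x \<subseteq> zeros x'" "f x' \<le> f x" by auto
qed

text \<open>Otherwise all coordinates in \<open>I\<close> that are nonzero at \<open>x\<close> would
  still be positive at step size \<open>\<gamma>\<close>, and \<open>\<gamma>\<close> could be
  increased; the others vanish at \<open>w\<close> too and do not restrict the step.\<close>

lemma max_away_step_new_zero:
  assumes x: "x \<in> P" and w: "w \<in> face_at P I x" and \<gamma>: "max_away_step I x w \<gamma>"
  shows "\<exists>i\<in>I. coord x i \<noteq> 0 \<and> coord (x + \<gamma> *\<^sub>R (x - w)) i = 0"
proof (rule ccontr)
  assume no: "\<not> ?thesis"
  have adm: "\<forall>i\<in>I. 0 \<le> coord x i + \<gamma> * (coord x i - coord w i)"
    and max: "\<And>s. \<forall>i\<in>I. 0 \<le> coord x i + s * (coord x i - coord w i) \<Longrightarrow> s \<le> \<gamma>"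
    using \<gamma> by (auto simp: max_away_step_def is_arg_max_linorder)
  define N where "N = {i \<in> I. coord x i \<noteq> 0}"
  have posN: "0 < coord x i + \<gamma> * (coord x i - coord w i)" if "i \<in> N" for i
    using no adm that by (auto simp: N_def less_le)
  \<comment> \<open>The element 1 keeps the minimum defined when \<open>N\<close> is empty, and the
    summand 1 in the denominators avoids division by zero.\<close>
  define Q where "Q = insert 1 ((\<lambda>i. (coord x i + \<gamma> * (coord x i - coord w i)) / (1 + \<bar>coord x i - coord w i\<bar>)) ` N)"
  define e where "e = Min Q"
  have Q: "finite Q" "Q \<noteq> {}" by (auto simp: Q_def N_def)
  have e: "0 < e" unfolding e_def
    using Q posN by (subst Min_gr_iff) (auto simp: Q_def intro!: divide_pos_pos)
  have "0 \<le> coord x i + (\<gamma> + e) * (coord x i - coord w i)" if i: "i \<in> I" for i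
  proof (cases "i \<in> N")
    case True
    then have "e \<le> (coord x i + \<gamma> * (coord x i - coord w i)) / (1 + \<bar>coord x i - coord w i\<bar>)"
      unfolding e_def using Q by (intro Min_le) (auto simp: Q_def)
    then have "e * (1 + \<bar>coord x i - coord w i\<bar>) \<le> coord x i + \<gamma> * (coord x i - coord w i)"
      by (subst (asm) pos_le_divide_eq) auto
    moreover have "e * - (coord x i - coord w i) \<le> e * \<bar>coord x i - coord w i\<bar>"
      using e by (intro mult_left_mono) auto
    ultimately show ?thesis using e by (simp add: algebra_simps)
  next
    case False
    then have "coord x i = 0" "coord w i = 0" using i w by (auto simp: N_def face_at_def)
    then show ?thesis by simp
  qed
  then have "\<gamma> + e \<le> \<gamma>" by (intro max) auto
  with e show False by simp
qed

text \<open>By convexity a line search that stops before the end of its interval minimizes along the whole ray.\<close>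

lemma interior_line_search_global:
  assumes x: "x \<in> Rn n" "d \<in> Rn n" and \<eta>: "exact_line_search f x d \<gamma> \<eta>" "\<eta> < \<gamma>" and s: "0 \<le> s"
  shows "f (x + \<eta> *\<^sub>R d) \<le> f (x + s *\<^sub>R d)"
proof (cases "s \<le> \<gamma>")
  case True
  then show ?thesis using line_searchD(3)[OF \<eta>(1)] s by blast
next
  case False
  define \<phi> where "\<phi> t = f (x + t *\<^sub>R d)" for t
  \<comment> \<open>\<open>\<gamma>\<close> is the convex combination of \<open>\<eta>\<close> and
    \<open>s\<close> with parameter \<open>t\<close>. As the value at \<open>\<eta>\<close> is at
    most that at \<open>\<gamma>\<close>, convexity forbids a smaller value at
    \<open>s\<close>.\<close>
  define t where "t = (\<gamma> - \<eta>) / (s - \<eta>)"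
  have t: "0 < t" "t < 1" using False \<eta>(2) by (auto simp: t_def divide_simps)
  have "t * (s - \<eta>) = \<gamma> - \<eta>" using False \<eta>(2) by (simp add: t_def)
  then have "(1 - t) * \<eta> + t * s = \<gamma>" by (simp add: algebra_simps)
  then have "\<phi> \<gamma> \<le> (1 - t) * \<phi> \<eta> + t * \<phi> s"
    using convex_onD[OF convex_on_line[OF convex_f x], of t \<eta> s] t by (simp add: \<phi>_def)
  moreover have "\<phi> \<eta> \<le> \<phi> \<gamma>"
    unfolding \<phi>_def using line_searchD[OF \<eta>(1)] by force
  ultimately have "t * \<phi> \<eta> \<le> t * \<phi> s" by (simp add: algebra_simps)
  then show ?thesis using t unfolding \<phi>_def by simp
qed

end

section \<open>Progress of the face-monotone steps\<close>

locale growth_problem = smooth_convex_problem +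
  fixes \<alpha>F :: real
  assumes slack: "\<And>v i. v \<in> verts P \<Longrightarrow> i \<in> I \<Longrightarrow> coord v i = 0 \<or> 1 \<le> coord v i"
    and \<alpha>F_pos: "0 < \<alpha>F" and facial_growth: "facial_quadratic_growth f P \<alpha>F"
begin

abbreviation "dim_opt \<equiv> real (affine_dim (optimal_face f P))"

text \<open>Condition number: steps without a new zero contract the gap by 1 - 1 / (16 \<kappa>).
  The maximum with 1 keeps this factor in [0, 1) and covers full steps, for which only halving of
  the gap is guaranteed.\<close>

definition \<kappa> :: real where
  "\<kappa> = max 1 (curv * (dim_opt + 1) / \<alpha>F)"

lemma \<kappa>_ge_1: "1 \<le> \<kappa>"
  by (simp add: \<kappa>_def)

text \<open>The vertices of the decomposition lie in every face that contains the minimizers, hence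
  in the optimal face, and their differences to one of them are independent in its direction
  space.\<close>

lemma minimizer_sparse_decomposition:
  assumes "y \<in> minimizers f P"
  obtains S l where "finite S" "S \<subseteq> verts P" "\<And>v. v \<in> S \<Longrightarrow> 0 < l v" "sum l S = (1::real)"
    "(\<Sum>v\<in>S. l v *\<^sub>R v) = y" "real (card S) \<le> dim_opt + 1"
proof -
  have yP: "y \<in> P" using mem_minimizersD[OF assms] by simp
  obtain S l u where S: "finite S" "S \<subseteq> verts P" "\<forall>v\<in>S. 0 < l v" "sum l S = (1::real)"
    "(\<Sum>v\<in>S. l v *\<^sub>R v) = y" "u \<in> S" "independent ((\<lambda>v. v - u) ` (S - {u}))"
    using affinely_independent_decomposition[OF yP] by blast
  let ?V = "{x - y |x y. x \<in> optimal_face f P \<and> y \<in> optimal_face f P}"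
  have SF: "S \<subseteq> F" if "F face_of P" "minimizers f P \<subseteq> F" for F
  proof (rule convex_combination_in_face[OF that(1) convex_P S(1) _ _ S(4)])
    show "S \<subseteq> P" using S(2) verts_sub by blast
    show "(\<Sum>v\<in>S. l v *\<^sub>R v) \<in> F" using S(5) assms that(2) by blast
  qed (use S(3) in simp)
  have SO: "S \<subseteq> optimal_face f P"
    unfolding optimal_face_def
  proof (rule Inter_greatest)
    fix F assume "F \<in> {F. F face_of P \<and> minimizers f P \<subseteq> F}"
    then have "F face_of P" "minimizers f P \<subseteq> F" by auto
    then show "S \<subseteq> F" by (rule SF)
  qed
  have "optimal_face f P \<subseteq> P"
    using face_of_refl[OF convex_P] minimizers_eq by (auto simp: optimal_face_def)
  then have "optimal_face f P \<subseteq> Rn n" using P_sub_Rn by blast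
  then have V: "?V \<subseteq> Rn n" by (auto intro!: Rn_diff)
  have "card (S - {u}) = card ((\<lambda>v. v - u) ` (S - {u}))"
    by (intro card_image[symmetric] inj_onI) simp
  also have "\<dots> \<le> dim ?V"
    using SO S(6) by (intro independent_card_le_dim_Rn[OF S(7) _ V]) auto
  finally have "card S \<le> affine_dim (optimal_face f P) + 1"
    using S(1,6) by (simp add: affine_dim_def)
  then show thesis using S by (intro that[of S l]) auto
qed

lemma toward_vertex_le:
  assumes "toward_vertex g P I x v" "z \<in> face_at P I x"
  shows "v \<bullet> g x \<le> z \<bullet> g x"
proof -
  have "z \<bullet> (- g x) \<le> - (v \<bullet> g x)"
    using assms(1) by (intro linear_le_on_face[OF _ assms(2)])
      (simp add: toward_vertex_def is_arg_min_linorder)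
  then show ?thesis by simp
qed

lemma away_vertex_ge:
  assumes "away_vertex g P I x w" "z \<in> face_at P I x"
  shows "z \<bullet> g x \<le> w \<bullet> g x"
  using assms(1) by (intro linear_le_on_face[OF _ assms(2)])
    (simp add: away_vertex_def is_arg_max_linorder)

text \<open>The gap is at most the pairing of \<open>x - y\<close> with the gradient, and replacing
  \<open>y\<close> by the toward vertex can only increase it, here to 0.\<close>

lemma fm_stop_optimal:
  assumes x: "x \<in> P" and stop: "fm_stop g P I x" and y: "y \<in> face_at P I x" "y \<in> minimizers f P"
  shows "f x - fmin \<le> 0"
proof -
  obtain v where "toward_vertex g P I x v" "(x - v) \<bullet> g x = 0" using stop by (auto simp: fm_stop_def)
  then show ?thesis
    using primal_gap_le[OF x y(2)] toward_vertex_le[OF _ y(1)] by (force simp: inner_diff_left)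
qed

text \<open>With gap h, width W and k vertices, transport gives h \<le> sqrt k * dist(x, y) * W for
  every minimizer y of the face. Taking the infimum over y, facial growth bounds the squared
  distance by 2 h / \<open>\<alpha>F\<close>, and one factor h cancels.\<close>

lemma gap_le_width:
  assumes x: "x \<in> P" and opt: "face_at P I x \<inter> minimizers f P \<noteq> {}"
    and v: "toward_vertex g P I x v" and w: "away_vertex g P I x w"
  shows "\<alpha>F * (f x - fmin) \<le> 2 * (dim_opt + 1) * ((w - v) \<bullet> g x)\<^sup>2"
proof (cases "f x - fmin \<le> 0")
  case True
  then have "\<alpha>F * (f x - fmin) \<le> 0" using \<alpha>F_pos by (simp add: mult_nonneg_nonpos)
  also have "0 \<le> 2 * (dim_opt + 1) * ((w - v) \<bullet> g x)\<^sup>2" by simp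
  finally show ?thesis .
next
  case False
  define h where "h = f x - fmin"
  define W where "W = (w - v) \<bullet> g x"
  define k where "k = dim_opt + 1"
  have h: "0 < h" using False by (simp add: h_def)
  have k: "0 < k" by (simp add: k_def add_nonneg_pos)
  have W0: "0 \<le> W"
    using toward_vertex_le[OF v self_in_face_at[OF x]] away_vertex_ge[OF w self_in_face_at[OF x]]
    by (simp add: W_def inner_diff_left)
  have *: "h \<le> sqrt k * dist x y * W" if y: "y \<in> minimizers f P \<inter> face_at P I x" for y
  proof -
    obtain S l where S: "finite S" "S \<subseteq> verts P" "\<And>v. v \<in> S \<Longrightarrow> 0 < l v" "sum l S = (1::real)"
        "(\<Sum>v\<in>S. l v *\<^sub>R v) = y" "real (card S) \<le> k"
      using minimizer_sparse_decomposition[of y] y unfolding k_def by blast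
    have "h \<le> (x - y) \<bullet> g x" using primal_gap_le[OF x] y by (simp add: h_def)
    also have "\<dots> \<le> sqrt (card S) * dist x y * (w \<bullet> g x - v \<bullet> g x)"
      using y by (intro transport_bound[OF slack x _ S(1-5)] toward_vertex_le[OF v] away_vertex_ge[OF w]) auto
    also have "\<dots> \<le> sqrt k * dist x y * W"
      using S(6) W0 by (auto simp: W_def inner_diff_left intro!: mult_right_mono)
    finally show ?thesis .
  qed
  obtain y where y: "y \<in> minimizers f P \<inter> face_at P I x" using opt by auto
  have W: "0 < W" using *[OF y] h W0 by (cases "W = 0") auto
  let ?X = "minimizers f P \<inter> face_at P I x"
  have "h / (sqrt k * W) \<le> infdist x ?X"
  proof -
    have "h / (sqrt k * W) \<le> dist x z" if "z \<in> ?X" for z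
      using *[OF that] k W by (simp add: field_simps)
    then show ?thesis using y by (auto simp: infdist_def intro!: cINF_greatest)
  qed
  then have "(h / (sqrt k * W))\<^sup>2 \<le> (infdist x ?X)\<^sup>2"
    using h k W by (intro power_mono) auto
  also have "\<dots> \<le> 2 / \<alpha>F * h"
    using facial_growth face_at_face_of[of x] opt self_in_face_at[OF x]
    unfolding facial_quadratic_growth_def h_def by blast
  finally have "h\<^sup>2 / (k * W\<^sup>2) \<le> 2 / \<alpha>F * h" using k by (simp add: power_divide power_mult_distrib)
  then have "\<alpha>F * h * h \<le> 2 * k * W\<^sup>2 * h"
    using k W \<alpha>F_pos by (simp add: field_simps power2_eq_square)
  then show ?thesis using h unfolding h_def k_def W_def by simp
qed

text \<open>The better of the two directions has slope G at least half of the width. The exceptions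
  are away steps stopped at the boundary, which create a zero, and toward steps of full length,
  where the gap is halved.\<close>

lemma fm_step_progress:
  assumes x: "x \<in> P" and opt: "face_at P I x \<inter> minimizers f P \<noteq> {}" and step: "fm_step f g P I x x'"
    and curv: "0 < curv"
  shows "zeros x \<subset> zeros x' \<or> f x' - fmin \<le> (1 - 1 / (16 * \<kappa>)) * (f x - fmin)"
proof -
  obtain v w where v: "toward_vertex g P I x v" and w: "away_vertex g P I x w"
    and alt: "if (x - v) \<bullet> g x > (w - x) \<bullet> g x
       then \<exists>\<eta>. exact_line_search f x (v - x) 1 \<eta> \<and> x' = x + \<eta> *\<^sub>R (v - x)
       else \<exists>\<gamma> \<eta>. max_away_step I x w \<gamma> \<and> exact_line_search f x (x - w) \<gamma> \<eta> \<and> x' = x + \<eta> *\<^sub>R (x - w)"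
    using step unfolding fm_step_def by blast
  have vP: "v \<in> P" and wF: "w \<in> face_at P I x"
    using v w by (auto simp: toward_vertex_def away_vertex_def is_arg_min_def is_arg_max_def face_at_def)
  then have wP: "w \<in> P" by (simp add: mem_face_at_iff)
  define B where "B = curv"
  define h where "h = f x - fmin"
  have B: "0 < B" using curv by (simp add: B_def)
  have h: "0 \<le> h" using fmin_le[OF x] by (simp add: h_def)
  \<comment> \<open>The constant 16: a factor 2 from \<open>gap_le_width\<close>, a factor 4 from W
    \<le> 2 G squared, and a factor 2 from the denominator of the decrease G^2 / (2 B).\<close>
  have sufficient: "f x' - fmin \<le> (1 - 1 / (16 * \<kappa>)) * (f x - fmin)"
    if G: "(w - v) \<bullet> g x \<le> 2 * G" "f x' \<le> f x - G\<^sup>2 / (2 * B)" for G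
  proof -
    define W where "W = (w - v) \<bullet> g x"
    have "0 \<le> W"
      using toward_vertex_le[OF v self_in_face_at[OF x]] away_vertex_ge[OF w self_in_face_at[OF x]]
      by (simp add: W_def inner_diff_left)
    then have "W\<^sup>2 \<le> (2 * G)\<^sup>2" using G(1) by (intro power_mono) (auto simp: W_def)
    have "\<alpha>F * h \<le> 2 * (dim_opt + 1) * W\<^sup>2"
      using gap_le_width[OF x opt v w] by (simp only: W_def h_def)
    also have "\<dots> \<le> 2 * (dim_opt + 1) * (4 * G\<^sup>2)"
      using \<open>W\<^sup>2 \<le> (2 * G)\<^sup>2\<close> by (intro mult_left_mono) (auto simp: power_mult_distrib)
    finally have "\<alpha>F * h \<le> 8 * (dim_opt + 1) * G\<^sup>2" by (simp add: algebra_simps)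
    then have "h \<le> 8 * ((dim_opt + 1) / \<alpha>F) * G\<^sup>2" using \<alpha>F_pos by (simp add: field_simps)
    also have "\<dots> = 16 * (B * (dim_opt + 1) / \<alpha>F) * (G\<^sup>2 / (2 * B))" using B by simp
    also have "\<dots> \<le> 16 * \<kappa> * (G\<^sup>2 / (2 * B))"
      using B by (intro mult_right_mono mult_left_mono) (auto simp: \<kappa>_def B_def)
    finally have "h / (16 * \<kappa>) \<le> G\<^sup>2 / (2 * B)"
      using \<kappa>_ge_1 by (subst pos_divide_le_eq) (auto simp: mult.commute)
    then show ?thesis using G(2) by (simp add: h_def algebra_simps)
  qed
  show ?thesis
  proof (cases "(x - v) \<bullet> g x > (w - x) \<bullet> g x")
    case True
    define G where "G = (x - v) \<bullet> g x"
    have WG: "(w - v) \<bullet> g x \<le> 2 * G" using True by (simp add: G_def inner_diff_left)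
    obtain \<eta> where \<eta>: "exact_line_search f x (v - x) 1 \<eta>" and x': "x' = x + \<eta> *\<^sub>R (v - x)"
      using alt True by auto
    have dec: "f x' \<le> f x - s * G + s\<^sup>2 * B / 2" if "0 \<le> s" "s \<le> 1" for s
      using line_searchD(3)[OF \<eta> that] descent[OF x vP x that(1)]
      by (simp add: x' G_def B_def inner_diff_left right_diff_distrib)
    have G0: "0 \<le> G" using toward_vertex_le[OF v self_in_face_at[OF x]] by (simp add: G_def inner_diff_left)
    show ?thesis
    proof (cases "G \<le> B")
      case True
      \<comment> \<open>G / B minimizes the quadratic model.\<close>
      have "f x' \<le> f x - (G / B) * G + (G / B)\<^sup>2 * B / 2"
        using True B G0 by (intro dec) auto
      also have "\<dots> = f x - G\<^sup>2 / (2 * B)" using B by (simp add: power2_eq_square field_simps)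
      finally show ?thesis using sufficient[OF WG] by blast
    next
      case False
      obtain y where y: "y \<in> face_at P I x" "y \<in> minimizers f P" using opt by auto
      have "h \<le> G"
        using primal_gap_le[OF x y(2)] toward_vertex_le[OF v y(1)] by (simp add: h_def G_def inner_diff_left)
      \<comment> \<open>For G > B the full step decreases \<open>f\<close> by at least G - B / 2 > G
        / 2, and G is at least the gap.\<close>
      then have "f x' - fmin \<le> h - h / 2"
        using dec[of 1] False by (simp add: h_def field_simps)
      also have "\<dots> \<le> h - h / (16 * \<kappa>)"
        using \<kappa>_ge_1 h by (intro diff_left_mono frac_le) auto
      finally show ?thesis by (simp add: h_def left_diff_distrib)
    qed
  next
    case False
    define G where "G = (w - x) \<bullet> g x"
    have WG: "(w - v) \<bullet> g x \<le> 2 * G" using False by (simp add: G_def inner_diff_left)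
    have G0: "0 \<le> G" using away_vertex_ge[OF w self_in_face_at[OF x]] by (simp add: G_def inner_diff_left)
    obtain \<gamma> \<eta> where \<gamma>: "max_away_step I x w \<gamma>" and \<eta>: "exact_line_search f x (x - w) \<gamma> \<eta>"
      and x': "x' = x + \<eta> *\<^sub>R (x - w)"
      using alt False by auto
    show ?thesis
    proof (cases "\<eta> = \<gamma>")
      case True
      have "zeros x \<subset> zeros x'"
        using max_away_step_new_zero[OF x wF \<gamma>] fm_step_basic(2)[OF x step] unfolding x' True by blast
      then show ?thesis by blast
    next
      case False
      then have "\<eta> < \<gamma>" using line_searchD(2)[OF \<eta>] by simp
      \<comment> \<open>The model's minimizer G / B may exceed \<open>\<gamma>\<close>; the
        comparison is still valid because a line search that stops before \<open>\<gamma>\<close> is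
        optimal on the whole ray.\<close>
      then have "f x' \<le> f (x + (G / B) *\<^sub>R (x - w))"
        unfolding x' using B G0 P_sub_Rn[OF x] P_sub_Rn[OF wP]
        by (intro interior_line_search_global[OF _ _ \<eta>]) auto
      also have "\<dots> \<le> f x + (G / B) * ((x - w) \<bullet> g x) + (G / B)\<^sup>2 * B / 2"
        using B G0 unfolding B_def by (intro descent[OF x x wP]) auto
      also have "\<dots> = f x - G\<^sup>2 / (2 * B)"
      proof -
        have "(x - w) \<bullet> g x = - G" by (simp add: G_def inner_diff_left)
        then show ?thesis using B by (simp add: power2_eq_square field_simps)
      qed
      finally show ?thesis using sufficient[OF WG] by blast
    qed
  qed
qed

section \<open>Runs of the face-monotone algorithm\<close>

lemma fm_trace_in_P:
  assumes "fm_trace f g P I K xs" "hd xs \<in> P" "j < length xs"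
  shows "xs ! j \<in> P"
  using assms(3)
proof (induction j)
  case 0
  then show ?case using assms(2) by (simp add: hd_conv_nth)
next
  case (Suc j)
  then show ?case using assms(1) fm_step_basic(1) by (auto simp: fm_trace_def)
qed

text \<open>A step that does not contract the gap creates a new zero coordinate, and zero coordinates persist.\<close>

lemma fm_trace_progress:
  assumes tr: "fm_trace f g P I K xs" and hd: "hd xs \<in> P" and curv: "0 < curv"
    and small: "f (hd xs) - fmin < H"
    and opt: "\<And>x. x \<in> P \<Longrightarrow> f x - fmin < H \<Longrightarrow> face_at P I x \<inter> minimizers f P \<noteq> {}"
    and j: "j < length xs"
  shows "f (xs ! j) - fmin < H \<and> (\<exists>s. j \<le> s + card (zeros (xs ! j)) \<and>
    f (xs ! j) - fmin \<le> (1 - 1 / (16 * \<kappa>)) ^ s * H)"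
  using j
proof (induction j)
  case 0
  then show ?case using small by (auto simp: hd_conv_nth intro!: exI[of _ 0])
next
  case (Suc j)
  define c where "c = 1 - 1 / (16 * \<kappa>)"
  have c: "0 \<le> c" using \<kappa>_ge_1 by (simp add: c_def)
  obtain s where s: "f (xs ! j) - fmin < H" "j \<le> s + card (zeros (xs ! j))" "f (xs ! j) - fmin \<le> c ^ s * H"
    using Suc by (auto simp: c_def)
  have P: "xs ! j \<in> P" using fm_trace_in_P[OF tr hd] Suc.prems by simp
  have step: "fm_step f g P I (xs ! j) (xs ! Suc j)" using tr Suc.prems by (auto simp: fm_trace_def)
  note basic = fm_step_basic[OF P step]
  have "\<exists>s. Suc j \<le> s + card (zeros (xs ! Suc j)) \<and> f (xs ! Suc j) - fmin \<le> c ^ s * H"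
  proof (cases "zeros (xs ! j) \<subset> zeros (xs ! Suc j)")
    case True
    then have "card (zeros (xs ! j)) < card (zeros (xs ! Suc j))" by (intro psubset_card_mono) auto
    then show ?thesis using s basic(3) by (intro exI[of _ s]) linarith
  next
    case False
    then have "f (xs ! Suc j) - fmin \<le> c * (f (xs ! j) - fmin)"
      using fm_step_progress[OF P opt[OF P s(1)] step curv] by (auto simp: c_def)
    also have "\<dots> \<le> c * (c ^ s * H)" using s c by (intro mult_left_mono)
    finally have "f (xs ! Suc j) - fmin \<le> c ^ Suc s * H" by simp
    moreover have "card (zeros (xs ! j)) \<le> card (zeros (xs ! Suc j))"
      using basic(2) by (intro card_mono) auto
    ultimately show ?thesis using s by (intro exI[of _ "Suc s"]) linarith
  qed
  then show ?case using s(1) basic(3) by (auto simp: c_def)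
qed

text \<open>An early return is optimal. Otherwise all \<open>K\<close> steps were made, at most |I|
  of them are charged to new zeros, and the others shrink the gap by the factor exp(-1 / (16
  \<kappa>)) or better.\<close>

lemma fm_trace_reaches:
  assumes tr: "fm_trace f g P I K xs" and hd: "hd xs \<in> P" and curv: "0 < curv"
    and small: "f (hd xs) - fmin < H" and H: "0 < H" and \<epsilon>: "0 < \<epsilon>"
    and opt: "\<And>x. x \<in> P \<Longrightarrow> f x - fmin < H \<Longrightarrow> face_at P I x \<inter> minimizers f P \<noteq> {}"
    and K: "real (card I) + 16 * \<kappa> * ln (H / \<epsilon>) \<le> real K"
  shows "f (last xs) - fmin \<le> \<epsilon>"
proof -
  have ne: "xs \<noteq> []" using tr by (simp add: fm_trace_def)
  define j where "j = length xs - 1"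
  have j: "j < length xs" "last xs = xs ! j" using ne by (auto simp: j_def last_conv_nth)
  have P: "xs ! j \<in> P" using fm_trace_in_P[OF tr hd j(1)] .
  define c where "c = 1 / (16 * \<kappa>)"
  have c: "0 < c" "c \<le> 1" using \<kappa>_ge_1 by (auto simp: c_def)
  obtain s where s: "f (xs ! j) - fmin < H" "j \<le> s + card (zeros (xs ! j))" "f (xs ! j) - fmin \<le> (1 - c) ^ s * H"
    using fm_trace_progress[OF tr hd curv small opt j(1)] by (auto simp: c_def)
  show ?thesis
  proof (cases "length xs < Suc K")
    case True
    then have "fm_stop g P I (xs ! j)" using tr j by (simp add: fm_trace_def)
    moreover obtain y where "y \<in> face_at P I (xs ! j)" "y \<in> minimizers f P" using opt[OF P s(1)] by auto
    ultimately show ?thesis using fm_stop_optimal[OF P] \<epsilon> j(2) by force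
  next
    case False
    then have "j = K" using tr by (auto simp: fm_trace_def j_def)
    moreover have "card (zeros (xs ! j)) \<le> card I" by (intro card_mono) auto
    ultimately have "16 * \<kappa> * ln (H / \<epsilon>) \<le> real s" using s(2) K by linarith
    then have "ln (H / \<epsilon>) \<le> c * real s" using \<kappa>_ge_1 by (simp add: c_def field_simps)
    have "(1 - c) ^ s \<le> exp (- c) ^ s"
      using c exp_ge_add_one_self[of "- c"] by (intro power_mono) auto
    also have "\<dots> = exp (- (c * real s))" by (simp add: exp_of_nat_mult[symmetric] mult.commute)
    also have "\<dots> \<le> exp (- ln (H / \<epsilon>))" using \<open>ln (H / \<epsilon>) \<le> c * real s\<close> by simp
    also have "\<dots> = \<epsilon> / H" using H \<epsilon> by (simp add: exp_minus)
    finally have "(1 - c) ^ s * H \<le> \<epsilon>" using H by (simp add: field_simps)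
    then show ?thesis using s(3) j(2) by simp
  qed
qed

end

section \<open>Oracle complexity\<close>

lemma phase_length_ge: "K0 * q ^ t \<le> real (phase_length K0 q t)"
  unfolding phase_length_def by linarith

lemma phase_length_le:
  assumes "1 \<le> K0" "1 < q"
  shows "real (phase_length K0 q t) \<le> 2 * K0 * q ^ t"
proof -
  have "1 * 1 \<le> K0 * q ^ t" using assms by (intro mult_mono one_le_power) auto
  then have "real (phase_length K0 q t) \<le> K0 * q ^ t + 1" unfolding phase_length_def by linarith
  with \<open>1 * 1 \<le> K0 * q ^ t\<close> show ?thesis by linarith
qed

text \<open>\<open>T\<close> is the first phase whose unrounded length reaches \<open>M\<close>. By
  minimality this length overshoots by a bounded factor, and the geometric sum up to
  \<open>T\<close> is comparable with its last term. The 2 absorbs the rounding.\<close>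

lemma exists_phase:
  assumes K0: "1 \<le> K0" and q: "1 < (q::real)" and M: "1 \<le> M"
  obtains T where "M \<le> real (phase_length K0 q T)"
    "(\<Sum>s\<le>T. real (phase_length K0 q s)) \<le> 2 * K0 * q\<^sup>2 / (q - 1) * M"
proof -
  define T where "T = (LEAST t. M \<le> K0 * q ^ t)"
  obtain t where "M < q ^ t" using real_arch_pow[OF q] by blast
  moreover have "q ^ t \<le> K0 * q ^ t" using K0 q by simp
  ultimately have ex: "M \<le> K0 * q ^ t" by linarith
  then have T: "M \<le> K0 * q ^ T" unfolding T_def by (rule LeastI)
  \<comment> \<open>One factor \<open>q\<close> is the overshoot at \<open>T\<close>, the other
    comes from the numerator of the geometric sum. For \<open>T = 0\<close> there is no previous
    phase to compare with, and the bound follows from 1 \<le> q M.\<close>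
  have top: "K0 * q ^ Suc T \<le> K0 * (q\<^sup>2 * M)"
  proof (cases T)
    case 0
    have "q * 1 \<le> q * (q * M)" using q M by (intro mult_left_mono) (auto intro: order_trans[OF _ mult_mono[of 1 q 1 M]])
    then show ?thesis using 0 K0 by (simp add: power2_eq_square mult.assoc)
  next
    case (Suc t)
    then have "\<not> M \<le> K0 * q ^ t" unfolding T_def using not_less_Least by (metis lessI)
    then have "q\<^sup>2 * (K0 * q ^ t) \<le> q\<^sup>2 * M" by (intro mult_left_mono) auto
    also have "1 * (q\<^sup>2 * M) \<le> K0 * (q\<^sup>2 * M)" using K0 M by (intro mult_right_mono) auto
    finally show ?thesis using Suc by (simp add: power2_eq_square mult_ac)
  qed
  have "(\<Sum>s\<le>T. real (phase_length K0 q s)) \<le> (\<Sum>s\<le>T. 2 * K0 * q ^ s)"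
    using K0 q by (intro sum_mono phase_length_le)
  also have "\<dots> = 2 * K0 * ((q ^ Suc T - 1) / (q - 1))"
    using q by (simp add: sum_distrib_left[symmetric] lessThan_Suc_atMost[symmetric] geometric_sum del: sum.lessThan_Suc)
  also have "\<dots> \<le> 2 * K0 * (q ^ Suc T / (q - 1))"
    using K0 q by (intro mult_left_mono divide_right_mono) auto
  also have "\<dots> = 2 / (q - 1) * (K0 * q ^ Suc T)" by simp
  also have "\<dots> \<le> 2 / (q - 1) * (K0 * (q\<^sup>2 * M))"
    by (rule mult_left_mono[OF top]) (use q in simp)
  also have "\<dots> = 2 * K0 * q\<^sup>2 / (q - 1) * M" by simp
  finally have "(\<Sum>s\<le>T. real (phase_length K0 q s)) \<le> 2 * K0 * q\<^sup>2 / (q - 1) * M" .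
  with T phase_length_ge[of K0 q T] show thesis by (intro that[of T]) auto
qed

text \<open>The two calls of the iteration that returns early are paid by a missing complete
  iteration, which would cost three.\<close>

lemma fm_calls_le:
  assumes "fm_trace f g P I K xs"
  shows "fm_calls K xs \<le> 3 * K"
proof -
  have "0 < length xs" "length xs \<le> Suc K" using assms by (auto simp: fm_trace_def)
  then show ?thesis unfolding fm_calls_def by (cases "length xs") auto
qed

lemma calls_before_le:
  assumes "alternating_run f g P I K0 q x1 cs fs"
  shows "calls_before K0 q cs fs T \<le> (\<Sum>s<T. 5 * phase_length K0 q s)"
  unfolding calls_before_def
proof (rule sum_mono)
  fix s
  have "cg_calls (cs s) = 2 * phase_length K0 q s"
    using assms by (auto simp: alternating_run_def cg_trace_def cg_calls_def)
  moreover have "fm_calls (phase_length K0 q s) (fs s) \<le> 3 * phase_length K0 q s"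
    using assms by (intro fm_calls_le) (auto simp: alternating_run_def)
  ultimately show "cg_calls (cs s) + fm_calls (phase_length K0 q s) (fs s) \<le> 5 * phase_length K0 q s"
    by simp
qed

lemma finds_initial_point:
  assumes "alternating_run f g P I K0 q x1 cs fs" "x1 \<in> P" "f x1 - min_value f P \<le> \<epsilon>" "0 \<le> B"
  shows "finds_within f P K0 q cs fs \<epsilon> B"
proof -
  have "cg_trace f g P (phase_length K0 q 0) (cs 0)" "hd (cs 0) = x1"
    using assms(1) unfolding alternating_run_def by auto
  then have "0 < length (cs 0)" "x1 = cs 0 ! 0"
    by (auto simp: cg_trace_def hd_conv_nth simp flip: length_greater_0_conv)
  then have "produced_after K0 q cs fs x1 0"
    unfolding produced_after_def by (intro disjI1 exI[of _ 0]) (simp add: calls_before_def)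
  then show ?thesis
    unfolding finds_within_def using assms by (intro exI[of _ x1] exI[of _ 0]) auto
qed

context growth_problem
begin

lemma run_in_P:
  assumes run: "alternating_run f g P I K0 q x1 cs fs" and x1: "x1 \<in> P"
  shows "hd (cs t) \<in> P" "hd (fs t) \<in> P"
proof -
  have cg: "cg_trace f g P (phase_length K0 q t) (cs t)"
    and fm: "fm_trace f g P I (phase_length K0 q t) (fs t)"
    and link: "hd (fs t) = last (cs t)" "hd (cs (Suc t)) = last (fs t)" for t
    using run by (auto simp: alternating_run_def)
  have cs_fs: "hd (fs t) \<in> P" if "hd (cs t) \<in> P" for t
  proof -
    have "last (cs t) = cs t ! phase_length K0 q t" using cg[of t]
      by (subst last_conv_nth) (auto simp: cg_trace_def)
    then show ?thesis using cg_trace_rate(1)[OF cg that order_refl] link by simp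
  qed
  show cs: "hd (cs t) \<in> P"
  proof (induction t)
    case 0
    then show ?case using run x1 by (simp add: alternating_run_def)
  next
    case (Suc t)
    have ne: "fs t \<noteq> []" using fm[of t] by (simp add: fm_trace_def)
    have "fs t ! (length (fs t) - 1) \<in> P"
      using ne by (intro fm_trace_in_P[OF fm cs_fs[OF Suc]]) auto
    then show ?case using ne link by (simp add: last_conv_nth)
  qed
  show "hd (fs t) \<in> P" using cs_fs[OF cs] .
qed

text \<open>\<open>H\<close> is left abstract so that both parts of the theorem are
  instances.\<close>

lemma alternating_finds:
  assumes run: "alternating_run f g P I K0 q x1 cs fs" and K0: "1 \<le> K0" and q: "1 < q"
    and x1: "x1 \<in> P" and I: "I \<noteq> {}" and H: "0 < H" and \<epsilon>: "0 < \<epsilon>" "\<epsilon> < H"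
    and opt: "\<And>x. x \<in> P \<Longrightarrow> f x - fmin < H \<Longrightarrow> face_at P I x \<inter> minimizers f P \<noteq> {}"
  shows "finds_within f P K0 q cs fs \<epsilon>
    (170 * K0 * q\<^sup>2 / (q - 1) * (curv / H + real (card I) + \<kappa> * ln (H / \<epsilon>)))"
proof -
  define L where "L = ln (H / \<epsilon>)"
  \<comment> \<open>The first term brings the gap below \<open>H\<close> in the CG part; the other
    two are what \<open>fm_trace_reaches\<close> asks for.\<close>
  define M where "M = 2 * (curv / H) + real (card I) + 16 * \<kappa> * L"
  have "0 \<le> L" using \<epsilon> by (simp add: L_def)
  then have L: "0 \<le> \<kappa> * L" using \<kappa>_ge_1 by simp
  have cH: "0 \<le> curv / H" using curv_nonneg H by simp
  \<comment> \<open>With \<open>I\<close> nonempty, \<open>M\<close> is at least 1, as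
    \<open>exists_phase\<close> requires.\<close>
  have "1 \<le> card I" using I by (simp add: Suc_le_eq card_gt_0_iff)
  then have M1: "1 \<le> M" using L cH by (simp add: M_def)
  obtain T where T: "M \<le> real (phase_length K0 q T)"
    "(\<Sum>s\<le>T. real (phase_length K0 q s)) \<le> 2 * K0 * q\<^sup>2 / (q - 1) * M"
    using exists_phase[OF K0 q M1] by blast
  define K where "K = phase_length K0 q T"
  have K1: "1 \<le> K" using T(1) M1 by (simp add: K_def)
  have cg: "cg_trace f g P K (cs T)" and fm: "fm_trace f g P I K (fs T)" and link: "hd (fs T) = last (cs T)"
    using run by (auto simp: alternating_run_def K_def)
  have ne: "fs T \<noteq> []" using fm by (simp add: fm_trace_def)
  have "last (cs T) = cs T ! K" using cg by (subst last_conv_nth) (auto simp: cg_trace_def)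
  then have rate: "f (hd (fs T)) - fmin \<le> 2 * curv / (real K + 1)"
    using cg_trace_rate(2)[OF cg run_in_P(1)[OF run x1] order_refl K1] link by simp
  have "2 * curv / H \<le> real K" using T(1) L by (simp add: K_def M_def)
  then have "2 * curv \<le> real K * H" using H by (simp add: field_simps)
  then have "2 * curv < H * (real K + 1)" using H by (simp add: algebra_simps)
  then have "2 * curv / (real K + 1) < H" by (subst pos_divide_less_eq) auto
  with rate have small: "f (hd (fs T)) - fmin < H" by simp
  have hdP: "hd (fs T) \<in> P" by (rule run_in_P(2)[OF run x1])
  \<comment> \<open>For vanishing curvature the rate shows that the first point of the FM trace is
    already optimal, so no progress of FM steps has to be shown.\<close>
  define j where "j = (if curv = 0 then 0 else length (fs T) - 1)"
  have j: "j < length (fs T)" "j \<le> K" using ne fm by (auto simp: j_def fm_trace_def)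
  have "f (fs T ! j) - fmin \<le> \<epsilon>"
  proof (cases "curv = 0")
    case True
    have "f (hd (fs T)) - fmin \<le> 0" using rate unfolding True by simp
    then show ?thesis using True \<epsilon> ne by (simp add: j_def hd_conv_nth)
  next
    case False
    then have "0 < curv" using curv_nonneg by linarith
    moreover have "real (card I) + 16 * \<kappa> * ln (H / \<epsilon>) \<le> real K"
      using T(1) cH by (simp add: K_def M_def L_def)
    ultimately have "f (last (fs T)) - fmin \<le> \<epsilon>"
      using fm_trace_reaches[OF fm hdP _ small H \<epsilon>(1) opt] by blast
    then show ?thesis using False ne by (simp add: j_def last_conv_nth)
  qed
  moreover have "fs T ! j \<in> P" by (rule fm_trace_in_P[OF fm hdP j(1)])
  moreover have "produced_after K0 q cs fs (fs T ! j) (calls_before K0 q cs fs T + cg_calls (cs T) + 3 * j)"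
    unfolding produced_after_def using j by blast
  moreover have "real (calls_before K0 q cs fs T + cg_calls (cs T) + 3 * j)
      \<le> 170 * K0 * q\<^sup>2 / (q - 1) * (curv / H + real (card I) + \<kappa> * L)"
  proof -
    have "cg_calls (cs T) = 2 * K" using cg by (simp add: cg_calls_def cg_trace_def)
    then have "calls_before K0 q cs fs T + cg_calls (cs T) + 3 * j \<le> (\<Sum>s<T. 5 * phase_length K0 q s) + 5 * K"
      using calls_before_le[OF run, of T] j(2) by linarith
    also have "\<dots> = (\<Sum>s\<le>T. 5 * phase_length K0 q s)"
      by (simp add: lessThan_Suc_atMost[symmetric] K_def)
    finally have "real (calls_before K0 q cs fs T + cg_calls (cs T) + 3 * j) \<le> real (\<Sum>s\<le>T. 5 * phase_length K0 q s)"
      by (rule of_nat_mono)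
    also have "\<dots> = 5 * (\<Sum>s\<le>T. real (phase_length K0 q s))" by (simp add: sum_distrib_left)
    also have "\<dots> \<le> 5 * (2 * K0 * q\<^sup>2 / (q - 1) * M)" using T(2) by simp
    also have "\<dots> = 10 * K0 * q\<^sup>2 / (q - 1) * M" by simp
    also have "\<dots> \<le> 10 * K0 * q\<^sup>2 / (q - 1) * (17 * (curv / H + real (card I) + \<kappa> * L))"
    proof (rule mult_left_mono)
      \<comment> \<open>The coefficients 2, 1 and 16 in \<open>M\<close> are all at most 17.
        Together with 5 calls per pair of iterations and the 2 of \<open>exists_phase\<close> this
        gives 170.\<close>
      show "M \<le> 17 * (curv / H + real (card I) + \<kappa> * L)"
        using L cH unfolding M_def distrib_left by linarith
    qed (use K0 q in simp)
    also have "\<dots> = 170 * K0 * q\<^sup>2 / (q - 1) * (curv / H + real (card I) + \<kappa> * L)" by simp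
    finally show ?thesis .
  qed
  ultimately show ?thesis unfolding finds_within_def L_def by blast
qed

section \<open>The critical distance and the two complexity bounds\<close>

text \<open>The zero set of \<open>x\<close> is itself a bad set, since the face it cuts out is the
  face of \<open>x\<close>. On these coordinates \<open>y\<close> agrees with \<open>y - x\<close>,
  so the restricted norm of \<open>y\<close> is at most the distance.\<close>

lemma critical_distance_le_dist:
  assumes x: "x \<in> P" and no: "face_at P I x \<inter> minimizers f P = {}" and y: "y \<in> minimizers f P"
  shows "critical_distance f P I \<le> ereal (dist x y)"
proof -
  have "face_fix P (zeros x) = face_at P I x" by (auto simp: face_fix_def face_at_def)
  then have bad: "zeros x \<in> bad_sets f P I"
    using no self_in_face_at[OF x] by (auto simp: bad_sets_def)
  have yP: "y \<in> P" using mem_minimizersD[OF y] by simp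
  have "critical_distance f P I \<le> ereal (L2_set (coord y) (zeros x))"
    unfolding critical_distance_def using bad y by (intro INF_lower2[of "zeros x"] INF_lower2[of y]) auto
  also have "L2_set (coord y) (zeros x) = L2_set (coord (y - x)) (zeros x)"
    by (intro L2_set_cong) auto
  also have "\<dots> \<le> L2_set (coord (y - x)) {..<n}"
    unfolding L2_set_def using I_sub by (intro real_sqrt_le_mono sum_mono2) auto
  also have "\<dots> = dist x y"
    using norm_Rn[OF Rn_diff[OF P_sub_Rn[OF yP] P_sub_Rn[OF x]]] by (simp add: dist_norm norm_minus_commute)
  finally show ?thesis by simp
qed

lemma optimal_in_face_of_small_gap:
  assumes \<alpha>: "0 < \<alpha>" and growth: "quadratic_growth f P \<alpha>" and r: "critical_distance f P I < \<infinity>"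
    and x: "x \<in> P" and gap: "f x - fmin < \<alpha> * (real_of_ereal (critical_distance f P I))\<^sup>2 / 2"
  shows "face_at P I x \<inter> minimizers f P \<noteq> {}"
proof
  assume no: "face_at P I x \<inter> minimizers f P = {}"
  define rr where "rr = real_of_ereal (critical_distance f P I)"
  have "0 \<le> critical_distance f P I"
    unfolding critical_distance_def by (intro INF_greatest) (simp add: L2_set_nonneg)
  then have rr: "critical_distance f P I = ereal rr" "0 \<le> rr"
    using r by (cases "critical_distance f P I"; simp add: rr_def)+
  have "(infdist x (minimizers f P))\<^sup>2 \<le> 2 / \<alpha> * (f x - fmin)"
    using growth x by (simp add: quadratic_growth_def)
  also have "\<dots> < rr\<^sup>2" using gap \<alpha> by (simp add: rr_def field_simps)
  finally have "infdist x (minimizers f P) < rr" using rr(2) by (rule power_less_imp_less_base)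
  moreover have "rr \<le> infdist x (minimizers f P)"
    using minimizers_ne critical_distance_le_dist[OF x no] rr(1)
    by (auto simp: infdist_def intro!: cINF_greatest)
  ultimately show False by simp
qed

text \<open>Here the starting point is optimal at cost 0, which settles the case that
  \<open>alternating_finds\<close> excludes.\<close>

lemma finds_if_no_constraints:
  assumes "I = {}" "alternating_run f g P I K0 q x1 cs fs" "x1 \<in> P" "0 < \<epsilon>" "0 \<le> B"
  shows "finds_within f P K0 q cs fs \<epsilon> B"
proof (rule finds_initial_point[OF assms(2,3) _ assms(5)])
  obtain y where "y \<in> minimizers f P" using minimizers_ne by blast
  then show "f x1 - fmin \<le> \<epsilon>"
    using mem_minimizersD[of y] singleton_if_no_constraints[OF assms(1,3), of y] assms(4) by auto
qed

lemma alternating_complexity: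
  assumes run: "alternating_run f g P I K0 q x1 cs fs" and K0: "1 \<le> K0" and q: "1 < q"
    and x1: "x1 \<in> P" and \<alpha>: "0 < \<alpha>" and growth: "quadratic_growth f P \<alpha>" and \<epsilon>: "0 < \<epsilon>"
  defines "r \<equiv> critical_distance f P I" and "C \<equiv> 340 * K0 * q\<^sup>2 / (q - 1)"
  defines "rr \<equiv> real_of_ereal r"
  shows "r < \<infinity> \<Longrightarrow> \<epsilon> < \<alpha> * rr\<^sup>2 / 2 \<Longrightarrow> finds_within f P K0 q cs fs \<epsilon>
      (C * (curv / (\<alpha> * rr\<^sup>2) + real (card I) + \<kappa> * log_plus (\<alpha> * rr\<^sup>2 / (2 * \<epsilon>))))"
    and "r = \<infinity> \<Longrightarrow> \<epsilon> < curv \<Longrightarrow> finds_within f P K0 q cs fs \<epsilon>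
      (C * (real (card I) + \<kappa> * log_plus (curv / \<epsilon>)))"
proof -
  have C: "0 \<le> C" using K0 q by (simp add: C_def)
  have mono: "finds_within f P K0 q cs fs \<epsilon> B'"
    if "finds_within f P K0 q cs fs \<epsilon> B" "B \<le> B'" for B B'
    using that unfolding finds_within_def by (meson order_trans)
  have log: "0 \<le> log_plus u" "ln u \<le> log_plus u" for u by (auto simp: log_plus_def)
  have \<kappa>log: "0 \<le> \<kappa> * log_plus u" for u using \<kappa>_ge_1 log by simp
  \<comment> \<open>The step from 170 to 340. The 2 absorbs curv / H = 2 curv / (\<alpha> rr^2) in
    the first part and the extra summand 1 \<le> |I| in the second.\<close>
  have half: "170 * K0 * q\<^sup>2 / (q - 1) * X \<le> C * Y" if "X \<le> 2 * Y" for X Y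
  proof -
    have "170 * K0 * q\<^sup>2 / (q - 1) * X \<le> 170 * K0 * q\<^sup>2 / (q - 1) * (2 * Y)"
      using that K0 q by (intro mult_left_mono) auto
    then show ?thesis by (simp add: C_def)
  qed
  {
    assume r: "r < \<infinity>" and small: "\<epsilon> < \<alpha> * rr\<^sup>2 / 2"
    define H where "H = \<alpha> * rr\<^sup>2 / 2"
    have H: "0 < H" using small \<epsilon> by (simp add: H_def)
    have c: "curv / (\<alpha> * rr\<^sup>2) = curv / H / 2" by (simp add: H_def)
    have c0: "0 \<le> curv / H" using curv_nonneg H by simp
    have HL: "\<alpha> * rr\<^sup>2 / (2 * \<epsilon>) = H / \<epsilon>" by (simp add: H_def)
    show "finds_within f P K0 q cs fs \<epsilon>
      (C * (curv / (\<alpha> * rr\<^sup>2) + real (card I) + \<kappa> * log_plus (\<alpha> * rr\<^sup>2 / (2 * \<epsilon>))))"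
      unfolding c HL
    proof (cases "I = {}")
      case True
      show "finds_within f P K0 q cs fs \<epsilon> (C * (curv / H / 2 + real (card I) + \<kappa> * log_plus (H / \<epsilon>)))"
        using C c0 \<kappa>_ge_1 log(1)
        by (intro finds_if_no_constraints[OF True run x1 \<epsilon>] mult_nonneg_nonneg add_nonneg_nonneg) auto
    next
      case False
      have opt: "face_at P I x \<inter> minimizers f P \<noteq> {}" if "x \<in> P" "f x - fmin < H" for x
        using optimal_in_face_of_small_gap[OF \<alpha> growth _ that(1)] r that(2) unfolding H_def rr_def r_def by blast
      have "finds_within f P K0 q cs fs \<epsilon> (170 * K0 * q\<^sup>2 / (q - 1) * (curv / H + real (card I) + \<kappa> * ln (H / \<epsilon>)))"
        using alternating_finds[OF run K0 q x1 False H \<epsilon>] small opt unfolding H_def by blast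
      then show "finds_within f P K0 q cs fs \<epsilon> (C * (curv / H / 2 + real (card I) + \<kappa> * log_plus (H / \<epsilon>)))"
      proof (rule mono)
        have "\<kappa> * ln (H / \<epsilon>) \<le> \<kappa> * log_plus (H / \<epsilon>)"
          using \<kappa>_ge_1 log(2) by (intro mult_left_mono) auto
        then show "170 * K0 * q\<^sup>2 / (q - 1) * (curv / H + real (card I) + \<kappa> * ln (H / \<epsilon>))
          \<le> C * (curv / H / 2 + real (card I) + \<kappa> * log_plus (H / \<epsilon>))"
          using \<kappa>log[of "H / \<epsilon>"] by (intro half) (simp add: distrib_left)
      qed
    qed
  }
  {
    assume r: "r = \<infinity>" and small: "\<epsilon> < curv"
    have H: "0 < curv" using small \<epsilon> by simp
    show "finds_within f P K0 q cs fs \<epsilon> (C * (real (card I) + \<kappa> * log_plus (curv / \<epsilon>)))"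
    proof (cases "I = {}")
      case True
      show ?thesis
        using C \<kappa>_ge_1 log(1) by (intro finds_if_no_constraints[OF True run x1 \<epsilon>] mult_nonneg_nonneg add_nonneg_nonneg) auto
    next
      case False
      then have I1: "1 \<le> real (card I)" by (simp add: Suc_le_eq card_gt_0_iff)
      \<comment> \<open>With infinite critical distance every face qualifies, so any positive
        threshold would do; \<beta> D^2 reduces the CG term to a constant.\<close>
      have opt: "face_at P I x \<inter> minimizers f P \<noteq> {}" if "x \<in> P" for x
      proof
        assume no: "face_at P I x \<inter> minimizers f P = {}"
        obtain y where "y \<in> minimizers f P" using minimizers_ne by blast
        then show False using critical_distance_le_dist[OF that no] r by (simp add: r_def)
      qed
      have "finds_within f P K0 q cs fs \<epsilon> (170 * K0 * q\<^sup>2 / (q - 1) * (curv / curv + real (card I) + \<kappa> * ln (curv / \<epsilon>)))"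
        using alternating_finds[OF run K0 q x1 False H \<epsilon> small] opt by blast
      then show ?thesis
      proof (rule mono)
        have "\<kappa> * ln (curv / \<epsilon>) \<le> \<kappa> * log_plus (curv / \<epsilon>)"
          using \<kappa>_ge_1 log(2) by (intro mult_left_mono) auto
        then have "1 + real (card I) + \<kappa> * ln (curv / \<epsilon>) \<le> 2 * (real (card I) + \<kappa> * log_plus (curv / \<epsilon>))"
          using \<kappa>log[of "curv / \<epsilon>"] I1 by (simp add: distrib_left)
        then show "170 * K0 * q\<^sup>2 / (q - 1) * (curv / curv + real (card I) + \<kappa> * ln (curv / \<epsilon>))
          \<le> C * (real (card I) + \<kappa> * log_plus (curv / \<epsilon>))"
          using H by (intro half) simp
      qed
    qed
  }
qed

end

theorem theorem2:
  fixes K0 q :: real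
  assumes "K0 \<ge> 1" and "q > 1"
  shows "\<exists>C>0. \<forall>(n::nat) (m::nat) (A :: nat \<Rightarrow> nat \<Rightarrow> real) (b :: nat \<Rightarrow> real) (I :: nat set) (P :: fseq set)
      (f :: fseq \<Rightarrow> real) (g :: fseq \<Rightarrow> fseq) (\<alpha>::real) (\<alpha>F::real) (\<beta>::real) (x1 :: fseq)
      (cs :: nat \<Rightarrow> fseq list) (fs :: nat \<Rightarrow> fseq list).
    I \<subseteq> {..<n} \<longrightarrow>
    P = polyhedron_of n m A b I \<longrightarrow>
    P \<noteq> {} \<longrightarrow>
    bounded P \<longrightarrow>
    (\<forall>v\<in>verts P. \<forall>i\<in>I. coord v i = 0 \<or> coord v i \<ge> 1) \<longrightarrow>
    convex_on (Rn n) f \<longrightarrow>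
    gradient_on n f g \<longrightarrow>
    continuous_on (Rn n) g \<longrightarrow>
    \<beta>-lipschitz_on (Rn n) g \<longrightarrow>
    \<alpha> > 0 \<longrightarrow>
    quadratic_growth f P \<alpha> \<longrightarrow>
    \<alpha>F > 0 \<longrightarrow>
    facial_quadratic_growth f P \<alpha>F \<longrightarrow>
    x1 \<in> P \<longrightarrow>
    alternating_run f g P I K0 q x1 cs fs \<longrightarrow>
    (let D = diameter P;
         d = real (affine_dim (optimal_face f P));
         r = critical_distance f P I;
         rr = real_of_ereal r
     in (r < \<infinity> \<longrightarrow>
          (\<forall>\<epsilon>. 0 < \<epsilon> \<and> \<epsilon> < \<alpha> * rr\<^sup>2 / 2 \<longrightarrow>
            finds_within f P K0 q cs fs \<epsilon>
              (C * (\<beta> * D\<^sup>2 / (\<alpha> * rr\<^sup>2) + real (card I)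
                 + max 1 (\<beta> * D\<^sup>2 * (d + 1) / \<alpha>F) * log_plus (\<alpha> * rr\<^sup>2 / (2 * \<epsilon>)))))) \<and>
        (r = \<infinity> \<longrightarrow>
          (\<forall>\<epsilon>. 0 < \<epsilon> \<and> \<epsilon> < \<beta> * D\<^sup>2 \<longrightarrow>
            finds_within f P K0 q cs fs \<epsilon>
              (C * (real (card I)
                 + max 1 (\<beta> * D\<^sup>2 * (d + 1) / \<alpha>F) * log_plus (\<beta> * D\<^sup>2 / \<epsilon>))))))"
proof (rule exI[of _ "340 * K0 * q\<^sup>2 / (q - 1)"], intro conjI allI impI)
  show "0 < 340 * K0 * q\<^sup>2 / (q - 1)" using assms by simp
next
  fix n m :: nat and A :: "nat \<Rightarrow> nat \<Rightarrow> real" and b :: "nat \<Rightarrow> real" and I :: "nat set" and P :: "fseq set"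
    and f :: "fseq \<Rightarrow> real" and g :: "fseq \<Rightarrow> fseq" and \<alpha> \<alpha>F \<beta> :: real and x1 :: fseq
    and cs fs :: "nat \<Rightarrow> fseq list"
  assume a: "I \<subseteq> {..<n}" "P = polyhedron_of n m A b I" "P \<noteq> {}" "bounded P"
    "\<forall>v\<in>verts P. \<forall>i\<in>I. coord v i = 0 \<or> coord v i \<ge> 1" "convex_on (Rn n) f" "gradient_on n f g"
    "continuous_on (Rn n) g" "\<beta>-lipschitz_on (Rn n) g" "\<alpha> > 0" "quadratic_growth f P \<alpha>" "\<alpha>F > 0"
    "facial_quadratic_growth f P \<alpha>F" "x1 \<in> P" "alternating_run f g P I K0 q x1 cs fs"
  interpret growth_problem n m A b I P f g \<beta> \<alpha>F
    by unfold_locales (use a in auto)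
  show "let D = diameter P;
         d = real (affine_dim (optimal_face f P));
         r = critical_distance f P I;
         rr = real_of_ereal r
     in (r < \<infinity> \<longrightarrow>
          (\<forall>\<epsilon>. 0 < \<epsilon> \<and> \<epsilon> < \<alpha> * rr\<^sup>2 / 2 \<longrightarrow>
            finds_within f P K0 q cs fs \<epsilon>
              (340 * K0 * q\<^sup>2 / (q - 1) * (\<beta> * D\<^sup>2 / (\<alpha> * rr\<^sup>2) + real (card I)
                 + max 1 (\<beta> * D\<^sup>2 * (d + 1) / \<alpha>F) * log_plus (\<alpha> * rr\<^sup>2 / (2 * \<epsilon>)))))) \<and>
        (r = \<infinity> \<longrightarrow>
          (\<forall>\<epsilon>. 0 < \<epsilon> \<and> \<epsilon> < \<beta> * D\<^sup>2 \<longrightarrow>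
            finds_within f P K0 q cs fs \<epsilon>
              (340 * K0 * q\<^sup>2 / (q - 1) * (real (card I)
                 + max 1 (\<beta> * D\<^sup>2 * (d + 1) / \<alpha>F) * log_plus (\<beta> * D\<^sup>2 / \<epsilon>)))))"
    unfolding Let_def \<kappa>_def[symmetric]
    using alternating_complexity[OF a(15) assms a(14,10,11)] by blast
qed

end
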